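(* Consider the human-AI queueing model and the UCB-DPP policy described in the context, with $K$, $\bm\lambda,\bm p,\bm\mu$ and $\bm r$ fixed. Assume that there exist $\varepsilon>0$ and $(\bm c^\varepsilon,\bm\rho^\varepsilon)$ with $c_k^\varepsilon\in[0,1]$, $\rho_k^\varepsilon\ge 0$, such that $$\lambda_k(1-p_kc_k^\varepsilon)+\varepsilon\le \mu_k\rho_k^\varepsilon\quad\text{for all }k\in[K],\qquad \sum_{k=1}^K\rho_k^\varepsilon\le 1.$$ For each horizon $T\ge 2$, run UCB-DPP with $V=\sqrt T$ and $\delta=T^{-2}$, and let $Q_{T+1,k}$ be the resulting terminal backlog of queue $k$. Then every human-service queue is mean-rate stable: $$\lim_{T\to\infty}\frac{\mathbb E[Q_{T+1,k}]}{T}=0\qquad\text{for all }k\in[K].$$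
   Context: Model. Fix integers $K,T\ge 1$, write $[K]=\{1,\dots,K\}$, and let $\lambda_k>0$, $\sum_k\lambda_k=1$, $p_k\in(0,1]$, $\mu_k\in(0,1]$. Weights $r_k\in[r_{\min},r_{\max}]$ with $0<r_{\min}<r_{\max}$. Queues $\bm Q_t=(Q_{t,1},\dots,Q_{t,K})\in\mathbb N^K$ start at $Q_{1,k}=0$. In each slot $t=1,\dots,T$: a task type $X_t\in[K]$ arrives, with $\mathbb P(X_t=k)=\lambda_k$, i.i.d. over time and independent of everything that happened before slot $t$; the controller observes $(\bm Q_t,X_t)$ and the past, and chooses a chatbot cost $c_t\in[0,1]$ and a queue $a_t\in[K]$. The chatbot outcome $Y_t\in\{0,1\}$ is, conditionally on the past, $X_t,c_t,a_t$, Bernoulli with parameter $p_{X_t}c_t$. Arrivals to the human queues are $A_{t,k}=\mathbf 1\{X_t=k\}(1-Y_t)$. Departures are $D_{t,k}=\mathbf 1\{a_t=k\}\mathbf 1\{Q_{t,k}>0\}B_{t,k}$, where, conditionally on the past, $X_t,c_t,a_t$, $B_{t,k}$ is Bernoulli($\mu_k$). Then $Q_{t+1,k}=Q_{t,k}+A_{t,k}-D_{t,k}$. UCB-DPP policy, with parameters $V>0$ and $\delta\in(0,1)$. Let $N_k(t)=\sum_{s\le t}\mathbf 1\{a_s=k,Q_{s,k}>0\}$, $S_k(t)=\sum_{s\le t}D_{s,k}$, $M_k(t)=\sum_{s\le t}c_s\mathbf 1\{X_s=k\}$, $G_k(t)=\sum_{s\le t}Y_s\mathbf 1\{X_s=k\}$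 (all $0$ at $t=0$). Let $\hat\mu_k(t)=S_k(t)/N_k(t)$ if $N_k(t)\ge1$ and $0$ otherwise; $\hat p_k(t)=G_k(t)/M_k(t)$ if $M_k(t)>0$ and $0$ otherwise. Confidence radii: $\beta^\mu_k(t)=1$ if $N_k(t)=0$ and $\sqrt{\log(4Kt/\delta)/(2N_k(t))}$ otherwise; $\beta^p_k(t)=1$ if $M_k(t)=0$ and $\sqrt{\log(4Kt/\delta)/(2M_k(t))}$ otherwise (in particular both equal $1$ at $t=0$). Optimistic estimates: $\bar\mu_k(t)=\min\{1,\hat\mu_k(t)+\beta_k^\mu(t)\}$, $\bar p_k(t)=\min\{1,\hat p_k(t)+\beta_k^p(t)\}$. At slot $t$ the policy plays $c_t=1$ if $r_{X_t}\bar p_{X_t}(t-1)Q_{t,X_t}\ge V$ and $c_t=0$ otherwise, and $a_t\in\arg\max_{j\in[K]}r_jQ_{t,j}\bar\mu_j(t-1)$ (arbitrary if all queues are empty). *)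

theory Defs
  imports "HOL-Probability.Probability"
begin

locale human_ai_params =
  fixes K :: nat
    and lam p mu r :: "nat \<Rightarrow> real"
    and rmin rmax :: real
  assumes K_ge_1: "1 \<le> K"
    and lam_pos: "\<And>k. k \<in> {1..K} \<Longrightarrow> 0 < lam k"
    and lam_sum: "(\<Sum>k=1..K. lam k) = 1"
    and p_range: "\<And>k. k \<in> {1..K} \<Longrightarrow> p k \<in> {0<..1}"
    and mu_range: "\<And>k. k \<in> {1..K} \<Longrightarrow> mu k \<in> {0<..1}"
    and rmin_pos: "0 < rmin"
    and rmin_less_rmax: "rmin < rmax"
    and r_range: "\<And>k. k \<in> {1..K} \<Longrightarrow> r k \<in> {rmin..rmax}"

text \<open>
  Processes are written \<open>X t \<omega>\<close>, \<open>Q t k \<omega>\<close>, and so on, with slot \<open>t\<close>, queue \<open>k\<close> and outcome \<open>\<omega>\<close>.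
\<close>

locale human_ai_process =
  fixes K :: nat
    and M :: "'a measure"
    and X :: "nat \<Rightarrow> 'a \<Rightarrow> nat"
    and c :: "nat \<Rightarrow> 'a \<Rightarrow> real"
    and a :: "nat \<Rightarrow> 'a \<Rightarrow> nat"
    and Y :: "nat \<Rightarrow> 'a \<Rightarrow> nat"
    and B :: "nat \<Rightarrow> nat \<Rightarrow> 'a \<Rightarrow> nat"
    and Q :: "nat \<Rightarrow> nat \<Rightarrow> 'a \<Rightarrow> nat"
begin

definition arrival :: "nat \<Rightarrow> nat \<Rightarrow> 'a \<Rightarrow> nat" where
  "arrival t k \<omega> = of_bool (X t \<omega> = k) * (1 - Y t \<omega>)"

definition departure :: "nat \<Rightarrow> nat \<Rightarrow> 'a \<Rightarrow> nat" where
  "departure t k \<omega> = of_bool (a t \<omega> = k) * of_bool (0 < Q t k \<omega>) * B t k \<omega>"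

text \<open>
  The past of slot \<open>t\<close> is the random element collecting everything that happened in slots
  \<open>1, \<dots>, t - 1\<close>. The queue lengths up to and including \<open>Q t\<close> are functions of it.
\<close>

definition past_space ::
    "nat \<Rightarrow> (nat \<Rightarrow> nat \<times> real \<times> nat \<times> nat \<times> (nat \<Rightarrow> nat)) measure" where
  "past_space t = (\<Pi>\<^sub>M s\<in>{1..<t}. count_space {1..K} \<Otimes>\<^sub>M borel \<Otimes>\<^sub>M count_space {1..K} \<Otimes>\<^sub>M
     count_space {0, 1} \<Otimes>\<^sub>M (\<Pi>\<^sub>M k\<in>{1..K}. count_space {0, 1}))"

definition past :: "nat \<Rightarrow> 'a \<Rightarrow> nat \<Rightarrow> nat \<times> real \<times> nat \<times> nat \<times> (nat \<Rightarrow> nat)" where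
  "past t \<omega> = (\<lambda>s\<in>{1..<t}. (X s \<omega>, c s \<omega>, a s \<omega>, Y s \<omega>, \<lambda>k\<in>{1..K}. B s k \<omega>))"

definition past_algebra :: "nat \<Rightarrow> 'a measure" where
  "past_algebra t = vimage_algebra (space M) (past t) (past_space t)"

text \<open>The \<open>\<sigma>\<close>-algebra generated by the past, \<open>X\<^sub>t\<close>, \<open>c\<^sub>t\<close> and \<open>a\<^sub>t\<close>.\<close>

definition decision_algebra :: "nat \<Rightarrow> 'a measure" where
  "decision_algebra t = vimage_algebra (space M) (\<lambda>\<omega>. (past t \<omega>, X t \<omega>, c t \<omega>, a t \<omega>))
     (past_space t \<Otimes>\<^sub>M count_space {1..K} \<Otimes>\<^sub>M borel \<Otimes>\<^sub>M count_space {1..K})"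

definition N :: "nat \<Rightarrow> nat \<Rightarrow> 'a \<Rightarrow> nat" where
  "N k t \<omega> = (\<Sum>s=1..t. of_bool (a s \<omega> = k \<and> 0 < Q s k \<omega>))"

definition S :: "nat \<Rightarrow> nat \<Rightarrow> 'a \<Rightarrow> nat" where
  "S k t \<omega> = (\<Sum>s=1..t. departure s k \<omega>)"

definition cost_count :: "nat \<Rightarrow> nat \<Rightarrow> 'a \<Rightarrow> real" where
  "cost_count k t \<omega> = (\<Sum>s=1..t. c s \<omega> * of_bool (X s \<omega> = k))"

definition G :: "nat \<Rightarrow> nat \<Rightarrow> 'a \<Rightarrow> nat" where
  "G k t \<omega> = (\<Sum>s=1..t. Y s \<omega> * of_bool (X s \<omega> = k))"

definition mu_hat :: "nat \<Rightarrow> nat \<Rightarrow> 'a \<Rightarrow> real" where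
  "mu_hat k t \<omega> = (if 1 \<le> N k t \<omega> then real (S k t \<omega>) / real (N k t \<omega>) else 0)"

definition p_hat :: "nat \<Rightarrow> nat \<Rightarrow> 'a \<Rightarrow> real" where
  "p_hat k t \<omega> = (if 0 < cost_count k t \<omega> then real (G k t \<omega>) / cost_count k t \<omega> else 0)"

definition beta_mu :: "real \<Rightarrow> nat \<Rightarrow> nat \<Rightarrow> 'a \<Rightarrow> real" where
  "beta_mu \<delta> k t \<omega> =
     (if N k t \<omega> = 0 then 1
      else sqrt (ln (4 * real K * real t / \<delta>) / (2 * real (N k t \<omega>))))"

definition beta_p :: "real \<Rightarrow> nat \<Rightarrow> nat \<Rightarrow> 'a \<Rightarrow> real" where
  "beta_p \<delta> k t \<omega> =
     (if cost_count k t \<omega> = 0 then 1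
      else sqrt (ln (4 * real K * real t / \<delta>) / (2 * cost_count k t \<omega>)))"

definition mu_bar :: "real \<Rightarrow> nat \<Rightarrow> nat \<Rightarrow> 'a \<Rightarrow> real" where
  "mu_bar \<delta> k t \<omega> = min 1 (mu_hat k t \<omega> + beta_mu \<delta> k t \<omega>)"

definition p_bar :: "real \<Rightarrow> nat \<Rightarrow> nat \<Rightarrow> 'a \<Rightarrow> real" where
  "p_bar \<delta> k t \<omega> = min 1 (p_hat k t \<omega> + beta_p \<delta> k t \<omega>)"

end

locale human_ai_model =
  human_ai_params K lam p mu r rmin rmax + prob_space M + human_ai_process K M X c a Y B Q
  for K :: nat and lam p mu r :: "nat \<Rightarrow> real" and rmin rmax :: real
    and T :: nat and M :: "'a measure" and X c a Y B Q +
  assumes T_ge_1: "1 \<le> T"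
    and X_measurable: "\<And>t. t \<in> {1..T} \<Longrightarrow> X t \<in> measurable M (count_space {1..K})"
    and c_measurable: "\<And>t. t \<in> {1..T} \<Longrightarrow> c t \<in> borel_measurable M"
    and c_range: "\<And>t \<omega>. t \<in> {1..T} \<Longrightarrow> \<omega> \<in> space M \<Longrightarrow> c t \<omega> \<in> {0..1}"
    and a_measurable: "\<And>t. t \<in> {1..T} \<Longrightarrow> a t \<in> measurable M (count_space {1..K})"
    and Y_measurable: "\<And>t. t \<in> {1..T} \<Longrightarrow> Y t \<in> measurable M (count_space {0, 1})"
    and B_measurable: "\<And>t k. t \<in> {1..T} \<Longrightarrow> k \<in> {1..K} \<Longrightarrow>
          B t k \<in> measurable M (count_space {0, 1})"
    and X_law: "\<And>t k. t \<in> {1..T} \<Longrightarrow> k \<in> {1..K} \<Longrightarrow>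
          prob {\<omega> \<in> space M. X t \<omega> = k} = lam k"
    and X_indep_past: "\<And>t. t \<in> {1..T} \<Longrightarrow>
          indep_set (sets (past_algebra t))
            (sets (vimage_algebra (space M) (X t) (count_space {1..K})))"
    and Y_law: "\<And>t. t \<in> {1..T} \<Longrightarrow>
          AE \<omega> in M. real_cond_exp M (decision_algebra t) (\<lambda>\<omega>'. of_bool (Y t \<omega>' = 1)) \<omega>
            = p (X t \<omega>) * c t \<omega>"
    and B_law: "\<And>t k. t \<in> {1..T} \<Longrightarrow> k \<in> {1..K} \<Longrightarrow>
          AE \<omega> in M. real_cond_exp M (decision_algebra t) (\<lambda>\<omega>'. of_bool (B t k \<omega>' = 1)) \<omega>
            = mu k"
    and Q_init: "\<And>k \<omega>. k \<in> {1..K} \<Longrightarrow> \<omega> \<in> space M \<Longrightarrow> Q 1 k \<omega> = 0"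
    and Q_step: "\<And>t k \<omega>. t \<in> {1..T} \<Longrightarrow> k \<in> {1..K} \<Longrightarrow> \<omega> \<in> space M \<Longrightarrow>
          Q (t + 1) k \<omega> = Q t k \<omega> + arrival t k \<omega> - departure t k \<omega>"

text \<open>
  The subtraction in the queue recursion is on \<^typ>\<open>nat\<close> but never truncates, since a departure
  requires a nonempty queue. Ties in the choice of the queue (in particular when all queues are
  empty) may be broken in any way, also by additional randomness, subject to the conditional laws
  of \<^locale>\<open>human_ai_model\<close>.
\<close>

locale ucb_dpp =
  human_ai_model K lam p mu r rmin rmax T M X c a Y B Q
  for K :: nat and lam p mu r :: "nat \<Rightarrow> real" and rmin rmax :: real
    and T :: nat and M :: "'a measure" and X c a Y B Q +
  fixes V \<delta> :: real
  assumes V_pos: "0 < V"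
    and delta_range: "\<delta> \<in> {0<..<1}"
    and c_policy: "\<And>t \<omega>. t \<in> {1..T} \<Longrightarrow> \<omega> \<in> space M \<Longrightarrow>
          c t \<omega> = (if V \<le> r (X t \<omega>) * p_bar \<delta> (X t \<omega>) (t - 1) \<omega> * real (Q t (X t \<omega>) \<omega>)
                   then 1 else 0)"
    and a_policy: "\<And>t \<omega>. t \<in> {1..T} \<Longrightarrow> \<omega> \<in> space M \<Longrightarrow>
          is_arg_max (\<lambda>j. r j * real (Q t j \<omega>) * mu_bar \<delta> j (t - 1) \<omega>) (\<lambda>j. j \<in> {1..K}) (a t \<omega>)"

end

theory Submission imports Defs "HOL-Real_Asymp.Real_Asymp" begin

text \<open>
  Let \<open>L\<^sub>t = \<Sum>\<^sub>k r\<^sub>k Q\<^sub>t\<^sub>,\<^sub>k\<^sup>2\<close>. Whenever all confidence intervals are valid, the drift of \<open>L\<close> under UCB-DPP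
  exceeds that of the randomized policy \<open>(c\<^sup>\<epsilon>, \<rho>\<^sup>\<epsilon>)\<close>, which is nonpositive on average, by at most a
  constant times \<open>V\<close> plus the confidence radii in use weighted by \<open>r Q\<close>, up to bounded terms. As each sample of an arm
  shrinks its radius like the inverse square root of the sample count, and \<open>Q \<le> T\<close> trivially, these
  errors add up to \<open>O(T\<^sup>3\<^sup>/\<^sup>2 (log T)\<^sup>1\<^sup>/\<^sup>2)\<close> over the horizon, while the invalid event has probability at
  most \<open>T \<delta> = 1 / T\<close> and costs \<open>O(T\<^sup>2)\<close>. Hence \<open>E L\<^sub>T\<^sub>+\<^sub>1 = o(T\<^sup>2)\<close>, and \<open>(E Q)\<^sup>2 \<le> E Q\<^sup>2\<close>.
\<close>

section \<open>Concentration with an adaptive number of samples\<close>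

text \<open>The event that all intervals are valid refers to the whole horizon, so conditioning on
  it would destroy the independence of the arrival from the past and the laws of the outcomes. Hence
  no expectation is restricted to it: the Bernoulli outcomes are averaged out on the full space,
  which leaves \<open>drift\<close>, and \<open>drift\<close> is compared with
  \<open>comparison_drift\<close> outcome by outcome. Only the sums over all slots are integrated,
  and \<open>comparison_drift\<close> has nonpositive mean on the full space.

  A second obstacle is that the policy decides when an arm is sampled, so the sample count is random
  and depends on earlier samples. Hoeffding's bound for a fixed sample size is replaced by an
  exponential supermartingale with fixed parameter and a union bound over the at most t positive
  counts. These t counts, the two signs and the 2K arms make up the 4Kt in the logarithm.

  The errors can be summed because each is charged to a slot that also yields a sample of the same
  arm: chatbot errors count only if the cost is 1, service errors only if the chosen queue is
  nonempty.\<close>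

lemma bernoulli_mgf_le:
  fixes h q :: real
  assumes q: "0 \<le> q" "q \<le> 1"
  shows "exp (- h * q) * (1 - q + q * exp h) \<le> exp (h\<^sup>2 / 8)"
proof -
  have *: "exp (- h * q) * (1 - q + q * exp h) \<le> exp (h\<^sup>2 / 8)"
    if h: "0 \<le> h" and q: "0 \<le> q" "q \<le> 1" for h q :: real
  proof -
    have "0 \<le> q * (exp h - 1)" using h q by simp
    hence pos: "0 < 1 + q * (exp h - 1)" by linarith
    have "exp (- h * q) * (1 - q + q * exp h) = exp (- h * q + ln (1 + q * (exp h - 1)))"
      using pos by (simp only: exp_add exp_ln) (simp add: algebra_simps)
    also have "\<dots> \<le> exp (h\<^sup>2 / 8)"
      using Hoeffdings_lemma_aux[OF h q(1)] by simp
    finally show ?thesis .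
  qed
  show ?thesis
  proof (cases "0 \<le> h")
    case False
    \<comment> \<open>Exchanging the outcomes 0 and 1 sends (h, q) to (-h, 1 - q) and reduces
      negative h to the case already treated.\<close>
    have "exp (- h * q) * (1 - q + q * exp h) =
          exp (- (- h) * (1 - q)) * (1 - (1 - q) + (1 - q) * exp (- h))"
    proof -
      have "exp (- (- h) * (1 - q)) = exp (- h * q) * exp h"
        by (simp add: algebra_simps flip: exp_add)
      moreover have "exp (- h * q) * exp h * (1 - (1 - q) + (1 - q) * exp (- h)) =
          exp (- h * q) * (q * exp h + (1 - q) * (exp h * exp (- h)))"
        by (simp only: algebra_simps)
      moreover have "exp h * exp (- h) = 1" by (simp flip: exp_add)
      ultimately show ?thesis by (simp add: algebra_simps)
    qed
    also have "\<dots> \<le> exp ((- h)\<^sup>2 / 8)" using False q by (intro *) auto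
    finally show ?thesis by simp
  qed (use * q in auto)
qed

text \<open>
  The arm with mean \<open>q\<close> is sampled in slot \<open>s\<close> iff \<open>\<xi> s = 1\<close>, and its sample is \<open>b s\<close>; the
  assumption \<open>cond\<close> says that, given \<open>F s\<close>, a sample taken in slot \<open>s\<close> has mean \<open>q\<close>.
\<close>

locale adaptive_bernoulli_samples = prob_space +
  fixes F :: "nat \<Rightarrow> 'a measure" and \<xi> b :: "nat \<Rightarrow> 'a \<Rightarrow> real" and q :: real and n :: nat
  assumes sub: "\<And>s. s \<in> {1..n} \<Longrightarrow> subalgebra M (F s)"
    and \<xi>_meas: "\<And>i s. 1 \<le> i \<Longrightarrow> i \<le> s \<Longrightarrow> s \<le> n \<Longrightarrow> \<xi> i \<in> borel_measurable (F s)"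
    and b_meas: "\<And>i s. 1 \<le> i \<Longrightarrow> i < s \<Longrightarrow> s \<le> n \<Longrightarrow> b i \<in> borel_measurable (F s)"
    and b_meas_M: "\<And>s. s \<in> {1..n} \<Longrightarrow> b s \<in> borel_measurable M"
    and \<xi>_01: "\<And>s \<omega>. s \<in> {1..n} \<Longrightarrow> \<omega> \<in> space M \<Longrightarrow> \<xi> s \<omega> \<in> {0, 1}"
    and b_01: "\<And>s \<omega>. s \<in> {1..n} \<Longrightarrow> \<omega> \<in> space M \<Longrightarrow> b s \<omega> \<in> {0, 1}"
    and q_01: "q \<in> {0..1}"
    and cond: "\<And>s W C. s \<in> {1..n} \<Longrightarrow> W \<in> borel_measurable (F s) \<Longrightarrow>
        (\<And>\<omega>. \<omega> \<in> space M \<Longrightarrow> \<bar>W \<omega>\<bar> \<le> C) \<Longrightarrow>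
        (\<integral>\<omega>. W \<omega> * \<xi> s \<omega> * b s \<omega> \<partial>M) = q * (\<integral>\<omega>. W \<omega> * \<xi> s \<omega> \<partial>M)"
begin

definition count :: "nat \<Rightarrow> 'a \<Rightarrow> real" where
  "count t \<omega> = (\<Sum>s=1..t. \<xi> s \<omega>)"

definition total :: "nat \<Rightarrow> 'a \<Rightarrow> real" where
  "total t \<omega> = (\<Sum>s=1..t. \<xi> s \<omega> * b s \<omega>)"

text \<open>Hoeffding's exponential process. The compensator h^2/8 is paid per sample and not per
  slot, so a slot without a sample leaves the value unchanged.\<close>

definition expo :: "real \<Rightarrow> nat \<Rightarrow> 'a \<Rightarrow> real" where
  "expo h t \<omega> = exp (h * (total t \<omega> - q * count t \<omega>) - h\<^sup>2 / 8 * count t \<omega>)"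

lemma \<xi>_meas_M: "s \<in> {1..n} \<Longrightarrow> \<xi> s \<in> borel_measurable M"
  using \<xi>_meas[of s s] sub[of s] measurable_from_subalg by auto

lemma count_meas: "t \<le> n \<Longrightarrow> count t \<in> borel_measurable M"
  unfolding count_def using \<xi>_meas_M by (intro borel_measurable_sum) auto

lemma total_meas: "t \<le> n \<Longrightarrow> total t \<in> borel_measurable M"
  unfolding total_def using \<xi>_meas_M b_meas_M
  by (intro borel_measurable_sum borel_measurable_times) auto

lemma expo_meas: "t \<le> n \<Longrightarrow> expo h t \<in> borel_measurable M"
  unfolding expo_def using count_meas[of t] total_meas[of t] by measurable

lemma expo_meas_sub:
  assumes "Suc t \<le> n"
  shows "expo h t \<in> borel_measurable (F (Suc t))"
proof -
  have "count t \<in> borel_measurable (F (Suc t))"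
    unfolding count_def using \<xi>_meas assms by (intro borel_measurable_sum) auto
  moreover have "total t \<in> borel_measurable (F (Suc t))"
    unfolding total_def using \<xi>_meas b_meas assms
    by (intro borel_measurable_sum borel_measurable_times) auto
  ultimately show ?thesis unfolding expo_def by measurable
qed

text \<open>Integrality of the count is what makes a union bound over its values finite.\<close>

lemma count_nat: "t \<le> n \<Longrightarrow> \<omega> \<in> space M \<Longrightarrow> \<exists>m\<le>t. count t \<omega> = real m"
proof (induction t)
  case (Suc t)
  then obtain m where m: "m \<le> t" "count t \<omega> = real m" by auto
  have "\<xi> (Suc t) \<omega> \<in> {0, 1}" using Suc.prems by (intro \<xi>_01) auto
  moreover have "count (Suc t) \<omega> = count t \<omega> + \<xi> (Suc t) \<omega>" by (simp add: count_def)
  ultimately show ?case using m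
    by (cases "\<xi> (Suc t) \<omega> = 0") (auto intro: exI[of _ m] exI[of _ "Suc m"])
qed (auto simp: count_def)

lemma total_bounds: "t \<le> n \<Longrightarrow> \<omega> \<in> space M \<Longrightarrow> 0 \<le> total t \<omega> \<and> total t \<omega> \<le> count t \<omega>"
  unfolding total_def count_def
proof (intro conjI sum_nonneg sum_mono)
  fix s assume "t \<le> n" "\<omega> \<in> space M" "s \<in> {1..t}"
  hence "\<xi> s \<omega> \<in> {0, 1}" "b s \<omega> \<in> {0, 1}" 
    using \<xi>_01[of s \<omega>] b_01[of s \<omega>] by auto
  thus "0 \<le> \<xi> s \<omega> * b s \<omega>" "\<xi> s \<omega> * b s \<omega> \<le> \<xi> s \<omega>" by auto
qed

lemma expo_bounded:
  assumes "t \<le> n" "\<omega> \<in> space M"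
  shows "\<bar>expo h t \<omega>\<bar> \<le> exp (\<bar>h\<bar> * t)"
proof -
  obtain m where m: "m \<le> t" "count t \<omega> = real m" using count_nat assms by blast
  have "0 \<le> total t \<omega>" "total t \<omega> \<le> count t \<omega>" using total_bounds assms by auto
  moreover have "0 \<le> q * count t \<omega>" "q * count t \<omega> \<le> 1 * count t \<omega>"
    using q_01 m by (simp_all add: mult_left_le_one_le)
  ultimately have "\<bar>total t \<omega> - q * count t \<omega>\<bar> \<le> t" using m by auto
  hence "\<bar>h * (total t \<omega> - q * count t \<omega>)\<bar> \<le> \<bar>h\<bar> * t"
    by (simp add: abs_mult mult_left_mono)
  moreover have "0 \<le> h\<^sup>2 / 8 * count t \<omega>" using m by simp
  ultimately show ?thesis unfolding expo_def by simp
qed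

lemma expo_integrable: "t \<le> n \<Longrightarrow> integrable M (expo h t)"
  using expo_bounded by (intro integrable_const_bound[of _ "exp (\<bar>h\<bar> * t)"] expo_meas) auto

lemma integrable_mult_01:
  assumes "integrable M f" "g \<in> borel_measurable M" "\<And>\<omega>. \<omega> \<in> space M \<Longrightarrow> g \<omega> \<in> {0, 1 :: real}"
  shows "integrable M (\<lambda>\<omega>. f \<omega> * g \<omega>)"
proof (rule Bochner_Integration.integrable_bound[OF assms(1)])
  show "AE \<omega> in M. norm (f \<omega> * g \<omega>) \<le> norm (f \<omega>)"
    using assms(3) by (intro AE_I2) force
qed (use assms in measurable)

text \<open>A sampled slot multiplies the process by a factor whose conditional mean is
  \<open>\<kappa> * (1 - q + q * exp h)\<close>, at most 1 by \<open>bernoulli_mgf_le\<close>; an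
  unsampled slot multiplies it by 1. Only expectations are tracked, since Markov's inequality asks
  for no more.\<close>

lemma expo_supermartingale: "t \<le> n \<Longrightarrow> (\<integral>\<omega>. expo h t \<omega> \<partial>M) \<le> 1"
proof (induction t)
  case 0
  show ?case by (simp add: expo_def count_def total_def prob_space)
next
  case (Suc t)
  define s where "s = Suc t"
  have s: "s \<in> {1..n}" using Suc.prems by (auto simp: s_def)
  define \<kappa> where "\<kappa> = exp (- h * q - h\<^sup>2 / 8)"
  let ?W = "expo h t"
  have W: "integrable M ?W" using Suc.prems by (intro expo_integrable) auto
  have W\<xi>: "integrable M (\<lambda>\<omega>. ?W \<omega> * \<xi> s \<omega>)"
    by (rule integrable_mult_01[OF W \<xi>_meas_M \<xi>_01]) (use s in auto)
  have W\<xi>b: "integrable M (\<lambda>\<omega>. ?W \<omega> * \<xi> s \<omega> * b s \<omega>)"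
    by (rule integrable_mult_01[OF W\<xi> b_meas_M b_01]) (use s in auto)
  have "(\<integral>\<omega>. expo h (Suc t) \<omega> \<partial>M) =
    (\<integral>\<omega>. ?W \<omega> + (\<kappa> - 1) * (?W \<omega> * \<xi> s \<omega>) + \<kappa> * (exp h - 1) * (?W \<omega> * \<xi> s \<omega> * b s \<omega>) \<partial>M)"
  proof (intro Bochner_Integration.integral_cong refl)
    fix \<omega> assume \<omega>: "\<omega> \<in> space M"
    have "expo h (Suc t) \<omega> = ?W \<omega> * exp (h * \<xi> s \<omega> * b s \<omega> - (h * q + h\<^sup>2 / 8) * \<xi> s \<omega>)"
      unfolding expo_def count_def total_def s_def
      by (simp flip: exp_add) (simp add: algebra_simps)
    \<comment> \<open>On the values 0 and 1 the exponential is a polynomial in \<xi> and \<xi> b,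
      the only two expressions about which \<open>cond\<close> speaks.\<close>
    also have "exp (h * \<xi> s \<omega> * b s \<omega> - (h * q + h\<^sup>2 / 8) * \<xi> s \<omega>) =
        1 + (\<kappa> - 1) * \<xi> s \<omega> + \<kappa> * (exp h - 1) * (\<xi> s \<omega> * b s \<omega>)"
      using \<xi>_01[OF s \<omega>] b_01[OF s \<omega>]
      by (auto simp: \<kappa>_def algebra_simps simp flip: exp_add)
    finally show "expo h (Suc t) \<omega> = ?W \<omega> + (\<kappa> - 1) * (?W \<omega> * \<xi> s \<omega>) +
        \<kappa> * (exp h - 1) * (?W \<omega> * \<xi> s \<omega> * b s \<omega>)"
      by (simp add: algebra_simps)
  qed
  also have "\<dots> = (\<integral>\<omega>. ?W \<omega> \<partial>M) + (\<kappa> - 1) * (\<integral>\<omega>. ?W \<omega> * \<xi> s \<omega> \<partial>M)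
      + \<kappa> * (exp h - 1) * (\<integral>\<omega>. ?W \<omega> * \<xi> s \<omega> * b s \<omega> \<partial>M)"
    using W W\<xi> W\<xi>b by simp
  also have "(\<integral>\<omega>. ?W \<omega> * \<xi> s \<omega> * b s \<omega> \<partial>M) = q * (\<integral>\<omega>. ?W \<omega> * \<xi> s \<omega> \<partial>M)"
    using Suc.prems by (intro cond[OF s _ expo_bounded[of t]]) (auto simp: s_def intro: expo_meas_sub)
  also have "(\<integral>\<omega>. ?W \<omega> \<partial>M) + (\<kappa> - 1) * (\<integral>\<omega>. ?W \<omega> * \<xi> s \<omega> \<partial>M)
      + \<kappa> * (exp h - 1) * (q * (\<integral>\<omega>. ?W \<omega> * \<xi> s \<omega> \<partial>M)) =
      (\<integral>\<omega>. ?W \<omega> \<partial>M) + (\<kappa> * (1 - q + q * exp h) - 1) * (\<integral>\<omega>. ?W \<omega> * \<xi> s \<omega> \<partial>M)"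
    by (simp add: algebra_simps)
  also have "\<dots> \<le> 1 + 0"
  proof (intro add_mono mult_nonpos_nonneg)
    have "\<kappa> * (1 - q + q * exp h) = exp (- h\<^sup>2 / 8) * (exp (- h * q) * (1 - q + q * exp h))"
      by (simp add: \<kappa>_def flip: exp_add mult.assoc)
    also have "\<dots> \<le> exp (- h\<^sup>2 / 8) * exp (h\<^sup>2 / 8)"
      using bernoulli_mgf_le q_01 by (intro mult_left_mono) auto
    finally show "\<kappa> * (1 - q + q * exp h) - 1 \<le> 0" by (simp flip: exp_add)
    show "0 \<le> (\<integral>\<omega>. ?W \<omega> * \<xi> s \<omega> \<partial>M)"
      using \<xi>_01[OF s] by (intro integral_nonneg_AE AE_I2) (force simp: expo_def)
  qed (use Suc in auto)
  finally show ?case by simp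
qed

text \<open>The event that the empirical mean misses q by more than sqrt (l / (2 n)), multiplied
  through by the count n to avoid division.\<close>

definition deviates :: "real \<Rightarrow> nat \<Rightarrow> 'a set" where
  "deviates l t = {\<omega> \<in> space M. 0 < count t \<omega> \<and>
     sqrt (count t \<omega> * l / 2) < \<bar>total t \<omega> - q * count t \<omega>\<bar>}"

lemma deviates_meas: "t \<le> n \<Longrightarrow> deviates l t \<in> events"
  unfolding deviates_def using count_meas[of t] total_meas[of t] by measurable

text \<open>
  A union bound over the value \<open>m\<close> of the count: for each \<open>m\<close> the exponent \<open>h\<close> is tuned so that
  a deviation forces \<open>expo h t \<ge> exp l\<close>, or the same with \<open>- h\<close>.
\<close>

lemma prob_deviates_le:
  assumes t: "t \<le> n" and l: "0 \<le> l"
  shows "prob (deviates l t) \<le> 2 * real t * exp (- l)"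
proof -
  \<comment> \<open>The maximizer of h d - h^2 m / 8 at the threshold d = sqrt (m l / 2), namely h =
    4 d / m. There the linear term is 2 l and the compensator is l, which leaves exponent l.\<close>
  define h where "h m = 4 * sqrt (l / (2 * real m))" for m :: nat
  define E where "E h = {\<omega> \<in> space M. exp l \<le> expo h t \<omega>}" for h
  have E_meas: "E h \<in> events" for h
    unfolding E_def using expo_meas[OF t, of h] by measurable
  have E_prob: "prob (E h) \<le> exp (- l)" for h
  proof -
    have "prob (E h) \<le> (\<integral>\<omega>. expo h t \<omega> \<partial>M) / exp l"
      unfolding E_def by (rule integral_Markov_inequality_measure[OF expo_integrable[OF t], of "{}"])
        (auto simp: expo_def)
    also have "\<dots> \<le> 1 / exp l" using expo_supermartingale[OF t] by (intro divide_right_mono) auto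
    finally show ?thesis by (simp add: exp_minus field_simps)
  qed
  have "deviates l t \<subseteq> (\<Union>m\<in>{1..t}. E (h m) \<union> E (- h m))"
  proof
    fix \<omega> assume "\<omega> \<in> deviates l t"
    hence \<omega>: "\<omega> \<in> space M" and pos: "0 < count t \<omega>"
      and dev: "sqrt (count t \<omega> * l / 2) < \<bar>total t \<omega> - q * count t \<omega>\<bar>"
      by (auto simp: deviates_def)
    obtain m where m: "m \<le> t" "count t \<omega> = real m" using count_nat[OF t \<omega>] by auto
    have m0: "0 < m" using pos m by auto
    have "h m * sqrt (real m * l / 2) = 4 * sqrt ((l / 2)\<^sup>2)"
      unfolding h_def using m0 by (simp add: power2_eq_square flip: real_sqrt_mult)
    hence h1: "h m * sqrt (real m * l / 2) = 2 * l" using l by (simp only: real_sqrt_abs)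
    have h2: "(h m)\<^sup>2 / 8 * real m = l" using m0 l by (simp add: h_def power_mult_distrib)
    have hm: "0 \<le> h m" by (simp add: h_def l)
    have "2 * l \<le> h m * \<bar>total t \<omega> - q * count t \<omega>\<bar>"
      unfolding h1[symmetric] using dev m hm by (intro mult_left_mono) auto
    hence "2 * l \<le> h m * (total t \<omega> - q * count t \<omega>) \<or>
        2 * l \<le> - h m * (total t \<omega> - q * count t \<omega>)"
      using minus_mult_commute[of "h m" "total t \<omega> - q * count t \<omega>"]
      by (cases "0 \<le> total t \<omega> - q * count t \<omega>") (simp_all only: abs_of_nonneg abs_of_neg not_le simp_thms)
    hence "\<omega> \<in> E (h m) \<or> \<omega> \<in> E (- h m)"
      using \<omega> h2 m by (auto simp: E_def expo_def)
    thus "\<omega> \<in> (\<Union>m\<in>{1..t}. E (h m) \<union> E (- h m))" using m m0 by auto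
  qed
  hence "prob (deviates l t) \<le> prob (\<Union>m\<in>{1..t}. E (h m) \<union> E (- h m))"
    using E_meas by (intro finite_measure_mono) auto
  also have "\<dots> \<le> (\<Sum>m\<in>{1..t}. prob (E (h m) \<union> E (- h m)))"
    using E_meas by (intro finite_measure_subadditive_finite) auto
  also have "\<dots> \<le> (\<Sum>m\<in>{1..t}. 2 * exp (- l))"
  proof (intro sum_mono)
    fix m
    have "prob (E (h m) \<union> E (- h m)) \<le> prob (E (h m)) + prob (E (- h m))"
      using E_meas by (intro measure_Un_le) auto
    thus "prob (E (h m) \<union> E (- h m)) \<le> 2 * exp (- l)"
      using E_prob[of "h m"] E_prob[of "- h m"] by linarith
  qed
  finally show ?thesis by simp
qed

end

section \<open>Confidence radii\<close>

lemma ucb_bracket: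
  fixes n s q l :: real
  assumes n: "0 < n" and q: "q \<le> 1" and dev: "\<bar>s - q * n\<bar> \<le> sqrt (n * l / 2)"
  shows "q \<le> min 1 (s / n + sqrt (l / (2 * n)))"
    and "min 1 (s / n + sqrt (l / (2 * n))) - q \<le> 2 * sqrt (l / (2 * n))"
proof -
  have "\<bar>s / n - q\<bar> = \<bar>s - q * n\<bar> / n"
    using n abs_divide[of "s - q * n" n] by (simp add: diff_divide_distrib)
  also have "\<dots> \<le> sqrt (n * l / 2) / n" using dev n by (intro divide_right_mono) auto
  also have "\<dots> = sqrt (n * l / 2) / sqrt (n\<^sup>2)" using n by simp
  also have "\<dots> = sqrt (n * l / 2 / n\<^sup>2)" by (simp only: real_sqrt_divide)
  also have "n * l / 2 / n\<^sup>2 = l / (2 * n)" using n by (simp add: power2_eq_square)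
  finally have "\<bar>s / n - q\<bar> \<le> sqrt (l / (2 * n))" .
  thus "q \<le> min 1 (s / n + sqrt (l / (2 * n)))"
    and "min 1 (s / n + sqrt (l / (2 * n))) - q \<le> 2 * sqrt (l / (2 * n))"
    using q by (auto simp: abs_le_iff)
qed

text \<open>The shape of a confidence radius as a function of the sample count, with the logarithm
  stripped off; the value at 0 mirrors the default radius 1 of an unsampled arm.\<close>

definition inv_sqrt1 :: "real \<Rightarrow> real" where
  "inv_sqrt1 x = (if x = 0 then 1 else 1 / sqrt x)"

text \<open>The right-hand side telescopes over successive counts. For positive m the difference of
  roots is 1 / (sqrt (m+1) + sqrt m), and sqrt (m+1) \<le> 2 sqrt m gives the factor 1 + 2 =
  3.\<close>

lemma inv_sqrt1_le: "inv_sqrt1 (real m) \<le> 3 * (sqrt (real (Suc m)) - sqrt (real m))"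
proof (cases "m = 0")
  case False
  define x where "x = sqrt (real m)"
  define y where "y = sqrt (real (Suc m))"
  have x: "1 \<le> x" using False by (simp add: x_def)
  have xy: "y\<^sup>2 - x\<^sup>2 = 1" by (simp add: x_def y_def)
  have "y \<le> 2 * x"
    unfolding x_def y_def using False
    by (intro real_le_lsqrt) (auto simp: power_mult_distrib)
  moreover have "0 < y" by (simp add: y_def)
  ultimately have "1 * (y + x) \<le> 3 * (y - x) * x * (y + x)"
  proof -
    have "3 * (y - x) * x * (y + x) = 3 * x * (y\<^sup>2 - x\<^sup>2)" by (simp add: power2_eq_square algebra_simps)
    thus ?thesis using \<open>y \<le> 2 * x\<close> xy by (simp only: mult_1 mult_1_right)
  qed
  hence "1 \<le> 3 * (y - x) * x" using x \<open>0 < y\<close> by (simp only: mult_le_cancel_right)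
  hence "1 / x \<le> 3 * (y - x)" using x by (simp add: field_simps)
  thus ?thesis using False by (simp add: inv_sqrt1_def x_def y_def)
qed (simp add: inv_sqrt1_def)

text \<open>The radius in use at slot s is based on the samples before s, so along the sampled slots
  the counts run through 0, 1, 2, ... and the bounds of \<open>inv_sqrt1_le\<close>
  telescope.\<close>

lemma sum_inv_sqrt1_le:
  fixes \<xi> :: "nat \<Rightarrow> real"
  assumes \<xi>: "\<And>s. s \<in> {1..t} \<Longrightarrow> \<xi> s \<in> {0, 1}"
  shows "(\<Sum>s=1..t. \<xi> s * inv_sqrt1 (\<Sum>i=1..s-1. \<xi> i)) \<le> 3 * sqrt (real t)"
proof -
  \<comment> \<open>The induction needs the bound in terms of the count m: a late first sample adds
    1 to the sum, far more than the growth of sqrt t in that slot.\<close>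
  have "\<exists>m\<le>t. (\<Sum>i=1..t. \<xi> i) = real m \<and>
      (\<Sum>s=1..t. \<xi> s * inv_sqrt1 (\<Sum>i=1..s-1. \<xi> i)) \<le> 3 * sqrt (real m)"
    using assms
  proof (induction t)
    case (Suc t)
    then obtain m where m: "m \<le> t" "(\<Sum>i=1..t. \<xi> i) = real m"
      "(\<Sum>s=1..t. \<xi> s * inv_sqrt1 (\<Sum>i=1..s-1. \<xi> i)) \<le> 3 * sqrt (real m)"
      by fastforce
    show ?case
    proof (cases "\<xi> (Suc t) = 0")
      case True
      thus ?thesis using m by (intro exI[of _ m]) auto
    next
      case False
      hence "\<xi> (Suc t) = 1" using Suc.prems[of "Suc t"] by auto
      thus ?thesis using m inv_sqrt1_le[of m] by (intro exI[of _ "Suc m"]) auto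
    qed
  qed auto
  then obtain m where m: "m \<le> t"
    "(\<Sum>s=1..t. \<xi> s * inv_sqrt1 (\<Sum>i=1..s-1. \<xi> i)) \<le> 3 * sqrt (real m)" by blast
  have "sqrt (real m) \<le> sqrt (real t)" using m by simp
  thus ?thesis using m by linarith
qed

text \<open>Twice the radius is sqrt (2 l / n). A common L for all slots bounds the varying l, and
  1/2 \<le> L makes sqrt (2 L) at least 1, so that the same expression also covers the default
  radius at n = 0.\<close>

lemma ucb_index_bounds:
  fixes n s q l L :: real
  assumes n: "0 \<le> n" and q: "q \<in> {0..1}" and L: "l \<le> L" "1 / 2 \<le> L"
    and dev: "0 < n \<Longrightarrow> \<bar>s - q * n\<bar> \<le> sqrt (n * l / 2)"
    and index: "u = min 1 ((if 0 < n then s / n else 0) + (if n = 0 then 1 else sqrt (l / (2 * n))))"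
  shows "q \<le> u" and "u - q \<le> sqrt (2 * L) * inv_sqrt1 n"
proof -
  have "q \<le> u \<and> u - q \<le> sqrt (2 * L) * inv_sqrt1 n"
  proof (cases "n = 0")
    case True
    hence "u = 1" using index by simp
    moreover have "1 \<le> sqrt (2 * L)" using L by simp
    moreover from this have "1 - q \<le> sqrt (2 * L)" using q unfolding atLeastAtMost_iff by linarith
    ultimately show ?thesis using q True by (auto simp: inv_sqrt1_def)
  next
    case False
    hence n: "0 < n" using n by simp
    have u: "u = min 1 (s / n + sqrt (l / (2 * n)))" using index n by simp
    have q1: "q \<le> 1" using q by simp
    have "2 * sqrt (l / (2 * n)) = sqrt (2\<^sup>2 * (l / (2 * n)))"
      by (simp only: real_sqrt_mult) simp
    also have "\<dots> = sqrt (2 * l / n)" by (simp add: field_simps)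
    also have "\<dots> \<le> sqrt (2 * L / n)" using L n by (simp add: divide_right_mono)
    also have "\<dots> = sqrt (2 * L) * inv_sqrt1 n" using n by (simp add: inv_sqrt1_def real_sqrt_divide)
    finally show ?thesis using ucb_bracket[OF n q1 dev[OF n]] u by auto
  qed
  thus "q \<le> u" and "u - q \<le> sqrt (2 * L) * inv_sqrt1 n" by auto
qed

section \<open>Measurability with respect to the past\<close>

context human_ai_process
begin

text \<open>The algebra is left open so that one argument about functions of observed slots, such as
  the queue lengths, serves the past, the decision algebra and the full space alike.\<close>

definition slot_measurable :: "'a measure \<Rightarrow> nat \<Rightarrow> bool" where
  "slot_measurable F s \<longleftrightarrow> X s \<in> F \<rightarrow>\<^sub>M count_space {1..K} \<and> c s \<in> borel_measurable F \<and>
     a s \<in> F \<rightarrow>\<^sub>M count_space {1..K} \<and> Y s \<in> F \<rightarrow>\<^sub>M count_space {0, 1} \<and>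
     (\<forall>k\<in>{1..K}. B s k \<in> F \<rightarrow>\<^sub>M count_space {0, 1})"

lemma past_measurable:
  assumes "\<And>s. s \<in> {1..<t} \<Longrightarrow> slot_measurable F s"
  shows "past t \<in> F \<rightarrow>\<^sub>M past_space t"
  unfolding past_def past_space_def
  using assms by (intro measurable_restrict measurable_Pair) (auto simp: slot_measurable_def)

lemma slot_measurable_if_past_measurable:
  assumes past: "past t \<in> F \<rightarrow>\<^sub>M past_space t" and s: "s \<in> {1..<t}"
  shows "slot_measurable F s"
proof -
  have *: "(\<lambda>\<omega>. past t \<omega> s) \<in> F \<rightarrow>\<^sub>M (count_space {1..K} \<Otimes>\<^sub>M borel \<Otimes>\<^sub>M count_space {1..K} \<Otimes>\<^sub>M
     count_space {0, 1} \<Otimes>\<^sub>M (\<Pi>\<^sub>M k\<in>{1..K}. count_space {0, 1}))"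
    using past s unfolding past_space_def
    by (intro measurable_compose[OF past[unfolded past_space_def] measurable_component_singleton])
  have eq: "past t \<omega> s = (X s \<omega>, c s \<omega>, a s \<omega>, Y s \<omega>, \<lambda>k\<in>{1..K}. B s k \<omega>)" for \<omega>
    using s by (simp add: past_def)
  note slot = *[unfolded eq]
  note 1 = measurable_compose[OF slot measurable_fst]
  note rest1 = measurable_compose[OF slot measurable_snd]
  note 2 = measurable_compose[OF rest1 measurable_fst]
  note rest2 = measurable_compose[OF rest1 measurable_snd]
  note 3 = measurable_compose[OF rest2 measurable_fst]
  note rest3 = measurable_compose[OF rest2 measurable_snd]
  note 4 = measurable_compose[OF rest3 measurable_fst]
  note rest4 = measurable_compose[OF rest3 measurable_snd]
  have 5: "B s k \<in> F \<rightarrow>\<^sub>M count_space {0, 1}" if k: "k \<in> {1..K}" for k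
    using measurable_compose[OF rest4 measurable_component_singleton[OF k]] k by simp
  show ?thesis unfolding slot_measurable_def using 1 2 3 4 5 by simp
qed

lemma space_past_algebra [simp]: "space (past_algebra t) = space M"
  by (simp add: past_algebra_def)

lemma space_decision_algebra [simp]: "space (decision_algebra t) = space M"
  by (simp add: decision_algebra_def)

end

lemma measurable_nat_of_subset:
  "f \<in> F \<rightarrow>\<^sub>M count_space A \<Longrightarrow> f \<in> F \<rightarrow>\<^sub>M count_space UNIV"
  using measurable_compose[of f F "count_space A" "\<lambda>x. x" "count_space UNIV"] by simp

section \<open>Adaptedness and deterministic bounds in the model\<close>

context human_ai_model
begin

lemma X_in: "t \<in> {1..T} \<Longrightarrow> \<omega> \<in> space M \<Longrightarrow> X t \<omega> \<in> {1..K}"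
  using measurable_space[OF X_measurable] by simp

lemma a_in: "t \<in> {1..T} \<Longrightarrow> \<omega> \<in> space M \<Longrightarrow> a t \<omega> \<in> {1..K}"
  using measurable_space[OF a_measurable] by simp

lemma Y_in: "t \<in> {1..T} \<Longrightarrow> \<omega> \<in> space M \<Longrightarrow> Y t \<omega> \<in> {0, 1}"
  using measurable_space[OF Y_measurable, of t \<omega>] by simp

lemma B_in: "t \<in> {1..T} \<Longrightarrow> k \<in> {1..K} \<Longrightarrow> \<omega> \<in> space M \<Longrightarrow> B t k \<omega> \<in> {0, 1}"
  using measurable_space[OF B_measurable, of t k \<omega>] by simp

lemma slot_measurable_M: "s \<in> {1..T} \<Longrightarrow> slot_measurable M s"
  unfolding slot_measurable_def
  using X_measurable c_measurable a_measurable Y_measurable B_measurable by simp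

lemma past_measurable_M: "t \<le> T + 1 \<Longrightarrow> past t \<in> M \<rightarrow>\<^sub>M past_space t"
  by (intro past_measurable slot_measurable_M) auto

lemma past_measurable_past_algebra: "t \<le> T + 1 \<Longrightarrow> past t \<in> past_algebra t \<rightarrow>\<^sub>M past_space t"
  unfolding past_algebra_def
  using measurable_space[OF past_measurable_M] by (intro measurable_vimage_algebra1) auto

lemma decision_measurable_M:
  assumes "t \<in> {1..T}"
  shows "(\<lambda>\<omega>. (past t \<omega>, X t \<omega>, c t \<omega>, a t \<omega>)) \<in>
    M \<rightarrow>\<^sub>M past_space t \<Otimes>\<^sub>M count_space {1..K} \<Otimes>\<^sub>M borel \<Otimes>\<^sub>M count_space {1..K}"
  using assms past_measurable_M X_measurable c_measurable a_measurable
  by (intro measurable_Pair) auto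

lemma decision_measurable_decision_algebra:
  assumes "t \<in> {1..T}"
  shows "(\<lambda>\<omega>. (past t \<omega>, X t \<omega>, c t \<omega>, a t \<omega>)) \<in>
    decision_algebra t \<rightarrow>\<^sub>M past_space t \<Otimes>\<^sub>M count_space {1..K} \<Otimes>\<^sub>M borel \<Otimes>\<^sub>M count_space {1..K}"
  unfolding decision_algebra_def
  using measurable_space[OF decision_measurable_M[OF assms]]
  by (intro measurable_vimage_algebra1) auto

lemma decision_components:
  assumes t: "t \<in> {1..T}"
  shows "past t \<in> decision_algebra t \<rightarrow>\<^sub>M past_space t"
    and "X t \<in> decision_algebra t \<rightarrow>\<^sub>M count_space {1..K}"
    and "c t \<in> borel_measurable (decision_algebra t)"
    and "a t \<in> decision_algebra t \<rightarrow>\<^sub>M count_space {1..K}"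
proof -
  note slot = decision_measurable_decision_algebra[OF t]
  note rest1 = measurable_compose[OF slot measurable_snd]
  note rest2 = measurable_compose[OF rest1 measurable_snd]
  show "past t \<in> decision_algebra t \<rightarrow>\<^sub>M past_space t"
    using measurable_compose[OF slot measurable_fst] by simp
  show "X t \<in> decision_algebra t \<rightarrow>\<^sub>M count_space {1..K}"
    using measurable_compose[OF rest1 measurable_fst] by simp
  show "c t \<in> borel_measurable (decision_algebra t)"
    using measurable_compose[OF rest2 measurable_fst] by simp
  show "a t \<in> decision_algebra t \<rightarrow>\<^sub>M count_space {1..K}"
    using measurable_compose[OF rest2 measurable_snd] by simp
qed

lemma subalgebra_past: "t \<le> T + 1 \<Longrightarrow> subalgebra M (past_algebra t)"
  unfolding subalgebra_def past_algebra_def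
  using sets_image_in_sets[OF refl past_measurable_M] by simp

lemma subalgebra_decision: "t \<in> {1..T} \<Longrightarrow> subalgebra M (decision_algebra t)"
  unfolding subalgebra_def decision_algebra_def
  using sets_image_in_sets[OF refl decision_measurable_M] by simp

lemma slot_measurable_past: "t \<le> T + 1 \<Longrightarrow> s \<in> {1..<t} \<Longrightarrow> slot_measurable (past_algebra t) s"
  by (rule slot_measurable_if_past_measurable[OF past_measurable_past_algebra])

lemma slot_measurable_decision: "t \<in> {1..T} \<Longrightarrow> s \<in> {1..<t} \<Longrightarrow> slot_measurable (decision_algebra t) s"
  by (rule slot_measurable_if_past_measurable[OF decision_components(1)])

lemma Q_measurable:
  assumes sp: "space F = space M" and k: "k \<in> {1..K}"
    and slot: "\<And>s. s \<in> {1..<t} \<Longrightarrow> slot_measurable F s" and t: "1 \<le> t" "t \<le> T + 1"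
  shows "Q t k \<in> F \<rightarrow>\<^sub>M count_space UNIV"
  using t(1) t(2) slot
proof (induction t rule: dec_induct)
  case base
  have "Q 1 k \<in> F \<rightarrow>\<^sub>M count_space UNIV \<longleftrightarrow> (\<lambda>_. 0 :: nat) \<in> F \<rightarrow>\<^sub>M count_space UNIV"
    using Q_init[OF k] by (intro measurable_cong) (auto simp: sp)
  thus ?case by simp
next
  case (step t)
  have t: "t \<in> {1..T}" using step by auto
  have Q: "Q t k \<in> F \<rightarrow>\<^sub>M count_space UNIV" using step by auto
  have slot: "slot_measurable F t" using step by auto
  note [measurable] = Q slot[unfolded slot_measurable_def, THEN conjunct1, THEN measurable_nat_of_subset]
  have [measurable]: "a t \<in> F \<rightarrow>\<^sub>M count_space UNIV" "Y t \<in> F \<rightarrow>\<^sub>M count_space UNIV"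
    "B t k \<in> F \<rightarrow>\<^sub>M count_space UNIV"
    using slot k by (auto simp: slot_measurable_def intro: measurable_nat_of_subset)
  have "Q (t + 1) k \<in> F \<rightarrow>\<^sub>M count_space UNIV \<longleftrightarrow>
      (\<lambda>\<omega>. Q t k \<omega> + of_bool (X t \<omega> = k) * (1 - Y t \<omega>)
         - of_bool (a t \<omega> = k) * of_bool (0 < Q t k \<omega>) * B t k \<omega>) \<in> F \<rightarrow>\<^sub>M count_space UNIV"
    using Q_step[OF t k] sp by (intro measurable_cong) (simp add: arrival_def departure_def)
  moreover have "(\<lambda>\<omega>. Q t k \<omega> + of_bool (X t \<omega> = k) * (1 - Y t \<omega>)
         - of_bool (a t \<omega> = k) * of_bool (0 < Q t k \<omega>) * B t k \<omega>) \<in> F \<rightarrow>\<^sub>M count_space UNIV"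
    by measurable
  ultimately show ?case by simp
qed

lemma Q_measurable_past: "1 \<le> t \<Longrightarrow> t \<le> T + 1 \<Longrightarrow> k \<in> {1..K} \<Longrightarrow>
    Q t k \<in> past_algebra t \<rightarrow>\<^sub>M count_space UNIV"
  by (intro Q_measurable slot_measurable_past) auto

lemma Q_measurable_decision: "t \<in> {1..T} \<Longrightarrow> s \<in> {1..t} \<Longrightarrow> k \<in> {1..K} \<Longrightarrow>
    Q s k \<in> decision_algebra t \<rightarrow>\<^sub>M count_space UNIV"
  by (intro Q_measurable slot_measurable_decision) auto

lemma Q_measurable_M: "1 \<le> t \<Longrightarrow> t \<le> T + 1 \<Longrightarrow> k \<in> {1..K} \<Longrightarrow> Q t k \<in> M \<rightarrow>\<^sub>M count_space UNIV"
  by (intro Q_measurable slot_measurable_M) auto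

lemma arrival_le: "arrival t k \<omega> \<le> 1"
  by (simp add: arrival_def)

lemma departure_le: "t \<in> {1..T} \<Longrightarrow> k \<in> {1..K} \<Longrightarrow> \<omega> \<in> space M \<Longrightarrow> departure t k \<omega> \<le> min 1 (Q t k \<omega>)"
  using B_in[of t k \<omega>] by (auto simp: departure_def)

lemma Q_le:
  assumes t: "1 \<le> t" "t \<le> T + 1" and k: "k \<in> {1..K}" and \<omega>: "\<omega> \<in> space M"
  shows "Q t k \<omega> \<le> t - 1"
  using t
proof (induction t rule: dec_induct)
  case base
  thus ?case using Q_init k \<omega> by simp
next
  case (step t)
  thus ?case using Q_step[of t k \<omega>] k \<omega> arrival_le[of t k \<omega>] by auto
qed

lemma Q_le_T: "t \<in> {1..T} \<Longrightarrow> k \<in> {1..K} \<Longrightarrow> \<omega> \<in> space M \<Longrightarrow> real (Q t k \<omega>) \<le> real T"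
  using Q_le[of t k \<omega>] by auto

section \<open>Conditional expectations\<close>

lemma integrable_bounded:
  fixes W :: "'a \<Rightarrow> real"
  assumes "W \<in> borel_measurable M" "\<And>\<omega>. \<omega> \<in> space M \<Longrightarrow> \<bar>W \<omega>\<bar> \<le> C"
  shows "integrable M W"
  using assms by (intro integrable_const_bound[of _ C]) auto

text \<open>The pull-out property of conditional expectation in integrated form: a bounded weight
  known at decision time sees only the conditional mean of the outcome.\<close>

lemma integral_mult_cond:
  assumes t: "t \<in> {1..T}" and W: "W \<in> borel_measurable (decision_algebra t)"
    and C: "\<And>\<omega>. \<omega> \<in> space M \<Longrightarrow> \<bar>W \<omega>\<bar> \<le> C"
    and Z: "Z \<in> M \<rightarrow>\<^sub>M count_space {0, 1 :: nat}"
    and law: "AE \<omega> in M. real_cond_exp M (decision_algebra t) (\<lambda>\<omega>'. of_bool (Z \<omega>' = 1)) \<omega> = q \<omega>"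
    and q: "q \<in> borel_measurable M"
  shows "(\<integral>\<omega>. W \<omega> * real (Z \<omega>) \<partial>M) = (\<integral>\<omega>. W \<omega> * q \<omega> \<partial>M)"
proof -
  interpret sub: finite_measure_subalgebra M "decision_algebra t"
    by unfold_locales (rule subalgebra_decision[OF t])
  have Zm [measurable]: "Z \<in> M \<rightarrow>\<^sub>M count_space UNIV" by (rule measurable_nat_of_subset[OF Z])
  have Z01: "Z \<omega> \<in> {0, 1}" if "\<omega> \<in> space M" for \<omega>
    using measurable_space[OF Z that] by simp
  have WM [measurable]: "W \<in> borel_measurable M"
    by (rule measurable_from_subalg[OF subalgebra_decision[OF t] W])
  have int: "integrable M (\<lambda>\<omega>. W \<omega> * of_bool (Z \<omega> = 1))"
    by (rule integrable_bounded[of _ C]) (use C in \<open>auto simp: of_bool_def intro: order_trans[OF abs_ge_zero]\<close>)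
  have "(\<integral>\<omega>. W \<omega> * real (Z \<omega>) \<partial>M) = (\<integral>\<omega>. W \<omega> * of_bool (Z \<omega> = 1) \<partial>M)"
    using Z01 by (intro Bochner_Integration.integral_cong) force+
  also have "\<dots> = (\<integral>\<omega>. W \<omega> * real_cond_exp M (decision_algebra t) (\<lambda>\<omega>'. of_bool (Z \<omega>' = 1)) \<omega> \<partial>M)"
    using sub.real_cond_exp_intg(2)[OF int W] by simp
  also have "\<dots> = (\<integral>\<omega>. W \<omega> * q \<omega> \<partial>M)"
    using law q by (intro integral_cong_AE) auto
  finally show ?thesis .
qed

lemma integral_mult_B:
  assumes "t \<in> {1..T}" "k \<in> {1..K}" "W \<in> borel_measurable (decision_algebra t)"
    "\<And>\<omega>. \<omega> \<in> space M \<Longrightarrow> \<bar>W \<omega>\<bar> \<le> C"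
  shows "(\<integral>\<omega>. W \<omega> * real (B t k \<omega>) \<partial>M) = mu k * (\<integral>\<omega>. W \<omega> \<partial>M)"
  using integral_mult_cond[OF assms(1,3,4) B_measurable B_law] assms by simp

lemma integral_mult_Y:
  assumes "t \<in> {1..T}" "W \<in> borel_measurable (decision_algebra t)"
    "\<And>\<omega>. \<omega> \<in> space M \<Longrightarrow> \<bar>W \<omega>\<bar> \<le> C"
  shows "(\<integral>\<omega>. W \<omega> * real (Y t \<omega>) \<partial>M) = (\<integral>\<omega>. W \<omega> * (p (X t \<omega>) * c t \<omega>) \<partial>M)"
proof (rule integral_mult_cond[OF assms Y_measurable Y_law])
  have [measurable]: "X t \<in> M \<rightarrow>\<^sub>M count_space UNIV" "c t \<in> borel_measurable M"
    using X_measurable c_measurable assms by (auto intro: measurable_nat_of_subset)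
  show "(\<lambda>\<omega>. p (X t \<omega>) * c t \<omega>) \<in> borel_measurable M" by measurable
qed (use assms in auto)

text \<open>Independence factorizes the integral. The weight must be measurable with respect to the
  past alone: the decision algebra already contains the arrival type.\<close>

lemma integral_mult_X:
  assumes t: "t \<in> {1..T}" and k: "k \<in> {1..K}" and W: "W \<in> borel_measurable (past_algebra t)"
    and C: "\<And>\<omega>. \<omega> \<in> space M \<Longrightarrow> \<bar>W \<omega>\<bar> \<le> C"
  shows "(\<integral>\<omega>. W \<omega> * of_bool (X t \<omega> = k) \<partial>M) = lam k * (\<integral>\<omega>. W \<omega> \<partial>M)"
proof -
  have X [measurable]: "X t \<in> M \<rightarrow>\<^sub>M count_space UNIV"
    using X_measurable[OF t] by (rule measurable_nat_of_subset)
  have WM [measurable]: "W \<in> borel_measurable M"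
    by (rule measurable_from_subalg[OF subalgebra_past W]) (use t in auto)
  let ?I = "\<lambda>\<omega>. of_bool (X t \<omega> = k) :: real"
  let ?V = "vimage_algebra (space M) (X t) (count_space {1..K})"
  have XV: "X t \<in> ?V \<rightarrow>\<^sub>M count_space {1..K}"
    using X_in t by (intro measurable_vimage_algebra1) auto
  have [measurable]: "X t \<in> ?V \<rightarrow>\<^sub>M count_space UNIV"
    by (rule measurable_nat_of_subset[OF XV])
  have IV: "?I \<in> borel_measurable ?V" by measurable
  have "indep_var borel W borel ?I"
    unfolding indep_var_eq
  proof (intro conjI)
    show "indep_set (sigma_sets (space M) {W -` A \<inter> space M |A. A \<in> sets borel})
      (sigma_sets (space M) {?I -` A \<inter> space M |A. A \<in> sets borel})"
      unfolding indep_set_def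
    proof (rule indep_sets_mono_sets[OF X_indep_past[OF t, unfolded indep_set_def]])
      fix i :: bool
      have "sigma_sets (space M) {W -` A \<inter> space M |A. A \<in> sets borel} \<subseteq> sets (past_algebra t)"
        using measurable_sets[OF W] sets.sigma_sets_subset[of "{W -` A \<inter> space M |A. A \<in> sets borel}" "past_algebra t"]
        by force
      moreover have "sigma_sets (space M) {?I -` A \<inter> space M |A. A \<in> sets borel} \<subseteq> sets ?V"
        using measurable_sets[OF IV] sets.sigma_sets_subset[of "{?I -` A \<inter> space M |A. A \<in> sets borel}" ?V]
        by force
      ultimately show "(case i of True \<Rightarrow> sigma_sets (space M) {W -` A \<inter> space M |A. A \<in> sets borel}
           | False \<Rightarrow> sigma_sets (space M) {?I -` A \<inter> space M |A. A \<in> sets borel})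
         \<subseteq> (case i of True \<Rightarrow> sets (past_algebra t) | False \<Rightarrow> sets ?V)"
        by (cases i) auto
    qed
  qed auto
  hence "(\<integral>\<omega>. W \<omega> * ?I \<omega> \<partial>M) = (\<integral>\<omega>. W \<omega> \<partial>M) * (\<integral>\<omega>. ?I \<omega> \<partial>M)"
    using C by (intro indep_var_lebesgue_integral integrable_bounded[of _ C] integrable_bounded[of _ 1]) auto
  also have "(\<integral>\<omega>. ?I \<omega> \<partial>M) = (\<integral>\<omega>. indicator {\<omega> \<in> space M. X t \<omega> = k} \<omega> \<partial>M)"
    by (intro Bochner_Integration.integral_cong) (auto simp: indicator_def)
  also have "\<dots> = lam k" using X_law[OF t k] by simp
  finally show ?thesis by simp
qed

end

section \<open>The estimates of the policy\<close>

lemma measurable_real_of_nat_subset: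
  "f \<in> F \<rightarrow>\<^sub>M count_space A \<Longrightarrow> (\<lambda>\<omega>. real (f \<omega>)) \<in> borel_measurable F"
  using measurable_compose[of f F "count_space A" real borel] by simp

context ucb_dpp
begin

lemma param_bounds:
  "k \<in> {1..K} \<Longrightarrow> 0 < r k" "k \<in> {1..K} \<Longrightarrow> r k \<le> rmax"
  "k \<in> {1..K} \<Longrightarrow> p k \<in> {0..1}" "k \<in> {1..K} \<Longrightarrow> mu k \<in> {0..1}" "0 < rmax"
  using r_range[of k] rmin_pos rmin_less_rmax p_range[of k] mu_range[of k] by auto

lemma c_01: "t \<in> {1..T} \<Longrightarrow> \<omega> \<in> space M \<Longrightarrow> c t \<omega> \<in> {0, 1}"
  using c_policy[of t \<omega>] by auto

definition mu_sampled :: "nat \<Rightarrow> nat \<Rightarrow> 'a \<Rightarrow> real" where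
  "mu_sampled k s \<omega> = of_bool (a s \<omega> = k \<and> 0 < Q s k \<omega>)"

text \<open>The cost itself serves as sampling indicator, as the policy spends only 0 or 1; the
  accumulated cost of a type is then a sample count.\<close>

definition p_sampled :: "nat \<Rightarrow> nat \<Rightarrow> 'a \<Rightarrow> real" where
  "p_sampled k s \<omega> = c s \<omega> * of_bool (X s \<omega> = k)"

lemma decision_measurable_nat:
  assumes "1 \<le> i" "i \<le> s" "s \<le> T"
  shows "X i \<in> decision_algebra s \<rightarrow>\<^sub>M count_space UNIV"
    and "a i \<in> decision_algebra s \<rightarrow>\<^sub>M count_space UNIV"
    and "c i \<in> borel_measurable (decision_algebra s)"
    and "k \<in> {1..K} \<Longrightarrow> Q i k \<in> decision_algebra s \<rightarrow>\<^sub>M count_space UNIV"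
proof -
  show "X i \<in> decision_algebra s \<rightarrow>\<^sub>M count_space UNIV" "a i \<in> decision_algebra s \<rightarrow>\<^sub>M count_space UNIV"
    "c i \<in> borel_measurable (decision_algebra s)"
    using slot_measurable_decision[of s i] decision_components[of s] assms
    by (cases "i = s"; auto simp: slot_measurable_def intro!: measurable_nat_of_subset)+
  show "k \<in> {1..K} \<Longrightarrow> Q i k \<in> decision_algebra s \<rightarrow>\<^sub>M count_space UNIV"
    using assms by (intro Q_measurable_decision) auto
qed

lemma mu_samples:
  assumes k: "k \<in> {1..K}"
  shows "adaptive_bernoulli_samples M decision_algebra (mu_sampled k) (\<lambda>s \<omega>. real (B s k \<omega>)) (mu k) T"
proof
  show meas: "mu_sampled k i \<in> borel_measurable (decision_algebra s)" if "1 \<le> i" "i \<le> s" "s \<le> T" for i s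
  proof -
    note [measurable] = decision_measurable_nat[OF that] decision_measurable_nat(4)[OF that k]
    show ?thesis unfolding mu_sampled_def by measurable
  qed
  show "(\<lambda>\<omega>. real (B i k \<omega>)) \<in> borel_measurable (decision_algebra s)" if "1 \<le> i" "i < s" "s \<le> T" for i s
    using slot_measurable_decision[of s i] k that
    by (intro measurable_real_of_nat_subset) (auto simp: slot_measurable_def)
  show "(\<lambda>\<omega>. real (B s k \<omega>)) \<in> borel_measurable M" if "s \<in> {1..T}" for s
    by (rule measurable_real_of_nat_subset[OF B_measurable[OF that k]])
  show "(\<integral>\<omega>. W \<omega> * mu_sampled k s \<omega> * real (B s k \<omega>) \<partial>M) = mu k * (\<integral>\<omega>. W \<omega> * mu_sampled k s \<omega> \<partial>M)"
    if s: "s \<in> {1..T}" and W: "W \<in> borel_measurable (decision_algebra s)"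
      and C: "\<And>\<omega>. \<omega> \<in> space M \<Longrightarrow> \<bar>W \<omega>\<bar> \<le> C" for s W C
  proof (rule integral_mult_B[OF s k])
    show "(\<lambda>\<omega>. W \<omega> * mu_sampled k s \<omega>) \<in> borel_measurable (decision_algebra s)"
      using W meas[of s s] s by auto
    show "\<bar>W \<omega> * mu_sampled k s \<omega>\<bar> \<le> C" if "\<omega> \<in> space M" for \<omega>
      using C[OF that] by (auto simp: mu_sampled_def)
  qed
  show "real (B s k \<omega>) \<in> {0, 1}" if "s \<in> {1..T}" "\<omega> \<in> space M" for s \<omega>
    using B_in[OF that(1) k that(2)] by auto
qed (use param_bounds k subalgebra_decision in \<open>auto simp: mu_sampled_def\<close>)

lemma p_samples:
  assumes k: "k \<in> {1..K}"
  shows "adaptive_bernoulli_samples M decision_algebra (p_sampled k) (\<lambda>s \<omega>. real (Y s \<omega>)) (p k) T"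
proof
  show meas: "p_sampled k i \<in> borel_measurable (decision_algebra s)" if "1 \<le> i" "i \<le> s" "s \<le> T" for i s
  proof -
    note [measurable] = decision_measurable_nat[OF that]
    show ?thesis unfolding p_sampled_def by measurable
  qed
  show sampled_01: "p_sampled k s \<omega> \<in> {0, 1}" if "s \<in> {1..T}" "\<omega> \<in> space M" for s \<omega>
    using c_01[OF that] by (auto simp: p_sampled_def)
  show "(\<lambda>\<omega>. real (Y i \<omega>)) \<in> borel_measurable (decision_algebra s)" if "1 \<le> i" "i < s" "s \<le> T" for i s
    using slot_measurable_decision[of s i] k that
    by (intro measurable_real_of_nat_subset) (auto simp: slot_measurable_def)
  show "(\<lambda>\<omega>. real (Y s \<omega>)) \<in> borel_measurable M" if "s \<in> {1..T}" for s
    by (rule measurable_real_of_nat_subset[OF Y_measurable[OF that]])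
  show "(\<integral>\<omega>. W \<omega> * p_sampled k s \<omega> * real (Y s \<omega>) \<partial>M) = p k * (\<integral>\<omega>. W \<omega> * p_sampled k s \<omega> \<partial>M)"
    if s: "s \<in> {1..T}" and W: "W \<in> borel_measurable (decision_algebra s)"
      and C: "\<And>\<omega>. \<omega> \<in> space M \<Longrightarrow> \<bar>W \<omega>\<bar> \<le> C" for s W C
  proof -
    have "(\<integral>\<omega>. W \<omega> * p_sampled k s \<omega> * real (Y s \<omega>) \<partial>M) =
        (\<integral>\<omega>. W \<omega> * p_sampled k s \<omega> * (p (X s \<omega>) * c s \<omega>) \<partial>M)"
    proof (rule integral_mult_Y[OF s])
      show "(\<lambda>\<omega>. W \<omega> * p_sampled k s \<omega>) \<in> borel_measurable (decision_algebra s)"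
        using W meas[of s s] s by auto
      show "\<bar>W \<omega> * p_sampled k s \<omega>\<bar> \<le> C" if "\<omega> \<in> space M" for \<omega>
        using C[OF that] sampled_01[OF s that] by auto
    qed
    \<comment> \<open>Where the slot is a sample, the type is k and the cost is 1, so the success
      probability is \<open>p k\<close>; elsewhere both integrands vanish.\<close>
    also have "\<dots> = (\<integral>\<omega>. p k * (W \<omega> * p_sampled k s \<omega>) \<partial>M)"
      using c_01[OF s] by (intro Bochner_Integration.integral_cong) (force simp: p_sampled_def)+
    finally show ?thesis by simp
  qed
  show "real (Y s \<omega>) \<in> {0, 1}" if "s \<in> {1..T}" "\<omega> \<in> space M" for s \<omega>
    using Y_in[OF that] by auto
qed (use param_bounds k subalgebra_decision in auto)

text \<open>\<open>G\<close> counts all successes, whereas the concentration bound counts those in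
  sampled slots. They agree almost surely: the nonnegative variable (1 - c) Y has mean E
  [(1 - c) p c], which is 0 for c in {0, 1}.\<close>

lemma AE_Y_le_c: "AE \<omega> in M. \<forall>t\<in>{1..T}. real (Y t \<omega>) \<le> c t \<omega>"
proof (intro AE_finite_allI)
  fix t assume t: "t \<in> {1..T}"
  have [measurable]: "Y t \<in> M \<rightarrow>\<^sub>M count_space UNIV" "c t \<in> borel_measurable M"
    using Y_measurable c_measurable t by (auto intro: measurable_nat_of_subset)
  have 01: "c t \<omega> \<in> {0, 1}" "Y t \<omega> \<in> {0, 1}" if "\<omega> \<in> space M" for \<omega>
    using c_01 Y_in t that by auto
  have "(\<integral>\<omega>. (1 - c t \<omega>) * real (Y t \<omega>) \<partial>M) = (\<integral>\<omega>. (1 - c t \<omega>) * (p (X t \<omega>) * c t \<omega>) \<partial>M)"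
    using decision_components(3)[OF t] 01 by (intro integral_mult_Y[OF t, of _ 1]) force+
  also have "\<dots> = (\<integral>\<omega>. 0 \<partial>M)"
    using 01 by (intro Bochner_Integration.integral_cong) force+
  finally have "(\<integral>\<omega>. (1 - c t \<omega>) * real (Y t \<omega>) \<partial>M) = 0" by simp
  moreover have "integrable M (\<lambda>\<omega>. (1 - c t \<omega>) * real (Y t \<omega>))"
    using 01 by (intro integrable_bounded[of _ 1]) force+
  ultimately have "AE \<omega> in M. (1 - c t \<omega>) * real (Y t \<omega>) = 0"
    using 01 by (subst integral_nonneg_eq_0_iff_AE[symmetric]) force+
  thus "AE \<omega> in M. real (Y t \<omega>) \<le> c t \<omega>"
    using AE_space by eventually_elim (use 01 in force)
qed auto

section \<open>Validity of the confidence intervals\<close>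

definition log_term :: "nat \<Rightarrow> real" where
  "log_term t = ln (4 * real K * real t / \<delta>)"

lemma log_term_mono: "1 \<le> s \<Longrightarrow> s \<le> t \<Longrightarrow> log_term s \<le> log_term t"
  unfolding log_term_def using K_ge_1 delta_range
  by (subst ln_le_cancel_iff) (auto intro!: divide_right_mono)

lemma log_term_ge:
  assumes "1 \<le> t"
  shows "1 / 2 \<le> log_term t"
proof -
  have "exp (1 / 2 :: real) \<le> 4" using exp_le exp_le_cancel_iff[of "1/2" "1 :: real"] by linarith
  also have "4 \<le> 4 * (real K * real t)" using K_ge_1 assms mult_mono[of 1 "real K" 1 "real t"] by simp
  also have "\<dots> \<le> 4 * (real K * real t) / \<delta>"
    using delta_range by (simp add: field_simps mult_left_le_one_le)
  finally have "exp (1 / 2) \<le> 4 * real K * real t / \<delta>" by (simp add: mult.assoc)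
  thus ?thesis unfolding log_term_def using K_ge_1 delta_range assms
    by (subst ln_ge_iff) auto
qed

text \<open>Time 0 needs no event: without samples both indices equal 1 and are valid by
  default.\<close>

definition bad :: "'a set" where
  "bad = (\<Union>t\<in>{1..T}. \<Union>k\<in>{1..K}.
     adaptive_bernoulli_samples.deviates M (mu_sampled k) (\<lambda>s \<omega>. real (B s k \<omega>)) (mu k) (log_term t) t \<union>
     adaptive_bernoulli_samples.deviates M (p_sampled k) (\<lambda>s \<omega>. real (Y s \<omega>)) (p k) (log_term t) t)"

lemma bad_meas: "bad \<in> events"
  unfolding bad_def
  using adaptive_bernoulli_samples.deviates_meas[OF mu_samples]
    adaptive_bernoulli_samples.deviates_meas[OF p_samples] by auto

text \<open>At time t one arm fails with probability at most 2 t exp (- \<open>log_term t\<close>) =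
  \<delta> / (2 K), and there are K arms of each of the two kinds; each time thus contributes
  \<delta>.\<close>

lemma prob_bad_le: "prob bad \<le> real T * \<delta>"
proof -
  let ?E = "\<lambda>t k. adaptive_bernoulli_samples.deviates M (mu_sampled k) (\<lambda>s \<omega>. real (B s k \<omega>)) (mu k) (log_term t) t"
  let ?F = "\<lambda>t k. adaptive_bernoulli_samples.deviates M (p_sampled k) (\<lambda>s \<omega>. real (Y s \<omega>)) (p k) (log_term t) t"
  have meas: "?E t k \<in> events" "?F t k \<in> events" if "t \<in> {1..T}" "k \<in> {1..K}" for t k
    using adaptive_bernoulli_samples.deviates_meas[OF mu_samples]
      adaptive_bernoulli_samples.deviates_meas[OF p_samples] that by auto
  have "prob bad \<le> (\<Sum>t\<in>{1..T}. prob (\<Union>k\<in>{1..K}. ?E t k \<union> ?F t k))"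
    unfolding bad_def
    by (rule finite_measure_subadditive_finite) (auto intro!: meas sets.finite_UN sets.Un)
  also have "\<dots> \<le> (\<Sum>t\<in>{1..T}. \<Sum>k\<in>{1..K}. prob (?E t k \<union> ?F t k))"
    by (intro sum_mono finite_measure_subadditive_finite) (auto intro!: meas)
  also have "\<dots> \<le> (\<Sum>t\<in>{1..T}. \<Sum>k\<in>{1..K}. \<delta> / real K)"
  proof (intro sum_mono)
    fix t k assume t: "t \<in> {1..T}" and k: "k \<in> {1..K}"
    have l: "0 \<le> log_term t" using log_term_ge[of t] t by auto
    have "exp (- log_term t) = \<delta> / (4 * real K * real t)"
      unfolding log_term_def exp_minus using K_ge_1 delta_range t by (subst exp_ln) auto
    hence *: "2 * real t * exp (- log_term t) = \<delta> / (2 * real K)" using t by simp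
    have "prob (?E t k \<union> ?F t k) \<le> prob (?E t k) + prob (?F t k)"
      using meas[OF t k] by (rule measure_Un_le)
    also have "\<dots> \<le> \<delta> / (2 * real K) + \<delta> / (2 * real K)"
      using adaptive_bernoulli_samples.prob_deviates_le[OF mu_samples[OF k] _ l, of t]
        adaptive_bernoulli_samples.prob_deviates_le[OF p_samples[OF k] _ l, of t] t
      unfolding * by (intro add_mono) auto
    finally show "prob (?E t k \<union> ?F t k) \<le> \<delta> / real K" by simp
  qed
  also have "\<dots> = real T * \<delta>" using K_ge_1 by simp
  finally show ?thesis .
qed

lemma mu_bar_bounds:
  assumes \<omega>: "\<omega> \<in> space M" "\<omega> \<notin> bad" and t: "t < T" and k: "k \<in> {1..K}"
  shows "mu k \<le> mu_bar \<delta> k t \<omega>"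
    and "mu_bar \<delta> k t \<omega> - mu k \<le> sqrt (2 * log_term T) * inv_sqrt1 (\<Sum>s=1..t. mu_sampled k s \<omega>)"
proof -
  interpret s: adaptive_bernoulli_samples M decision_algebra "mu_sampled k" "\<lambda>s \<omega>. real (B s k \<omega>)" "mu k" T
    by (rule mu_samples[OF k])
  have n: "s.count t \<omega> = real (N k t \<omega>)"
    by (simp add: s.count_def N_def mu_sampled_def)
  have tot: "s.total t \<omega> = real (S k t \<omega>)"
    by (simp add: s.total_def S_def departure_def mu_sampled_def of_bool_conj)
  have dev: "\<bar>s.total t \<omega> - mu k * s.count t \<omega>\<bar> \<le> sqrt (s.count t \<omega> * log_term t / 2)" if "0 < s.count t \<omega>"
  proof -
    have "t \<noteq> 0" using that by (intro notI) (simp add: s.count_def)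
    hence "\<omega> \<notin> s.deviates (log_term t) t" using \<omega>(2) t k by (auto simp: bad_def)
    thus ?thesis using \<omega>(1) that by (auto simp: s.deviates_def)
  qed
  \<comment> \<open>The 0 is a placeholder: at t = 0 the count is 0 and the radius takes its default
    value without evaluating the logarithm.\<close>
  have l: "(if t = 0 then 0 else log_term t) \<le> log_term T" "1 / 2 \<le> log_term T"
    using log_term_mono[of t T] log_term_ge[of T] T_ge_1 t by auto
  have c0: "s.count 0 \<omega> = 0" by (simp add: s.count_def)
  have index: "mu_bar \<delta> k t \<omega> = min 1 ((if 0 < s.count t \<omega> then s.total t \<omega> / s.count t \<omega> else 0)
      + (if s.count t \<omega> = 0 then 1 else sqrt ((if t = 0 then 0 else log_term t) / (2 * s.count t \<omega>))))"
    using c0 unfolding mu_bar_def mu_hat_def beta_mu_def log_term_def n tot by (cases "t = 0") (auto simp: n)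
  have "0 \<le> s.count t \<omega>" by (simp add: n)
  note * = ucb_index_bounds[OF this s.q_01 l _ index]
  show "mu k \<le> mu_bar \<delta> k t \<omega>"
    using dev c0 by (intro *) (cases "t = 0"; auto)
  show "mu_bar \<delta> k t \<omega> - mu k \<le> sqrt (2 * log_term T) * inv_sqrt1 (\<Sum>s=1..t. mu_sampled k s \<omega>)"
    unfolding s.count_def[symmetric] using dev c0 by (intro *) (cases "t = 0"; auto)
qed

lemma p_bar_bounds:
  assumes \<omega>: "\<omega> \<in> space M" "\<omega> \<notin> bad" and Yc: "\<forall>t\<in>{1..T}. real (Y t \<omega>) \<le> c t \<omega>"
    and t: "t < T" and k: "k \<in> {1..K}"
  shows "p k \<le> p_bar \<delta> k t \<omega>"
    and "p_bar \<delta> k t \<omega> - p k \<le> sqrt (2 * log_term T) * inv_sqrt1 (\<Sum>s=1..t. p_sampled k s \<omega>)"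
proof -
  interpret s: adaptive_bernoulli_samples M decision_algebra "p_sampled k" "\<lambda>s \<omega>. real (Y s \<omega>)" "p k" T
    by (rule p_samples[OF k])
  have n: "s.count t \<omega> = cost_count k t \<omega>"
    by (simp add: s.count_def cost_count_def p_sampled_def)
  \<comment> \<open>\<open>Yc\<close> enters here: at cost 0 there is no success, so dropping the
    cost factor changes nothing.\<close>
  have "p_sampled k s \<omega> * real (Y s \<omega>) = real (Y s \<omega> * of_bool (X s \<omega> = k))" if "s \<in> {1..t}" for s
  proof -
    have s: "s \<in> {1..T}" using that t by auto
    thus ?thesis using c_01[OF s \<omega>(1)] Yc[rule_format, OF s] by (auto simp: p_sampled_def)
  qed
  hence tot: "s.total t \<omega> = real (G k t \<omega>)"
    unfolding s.total_def G_def of_nat_sum by (intro sum.cong) auto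
  have dev: "\<bar>s.total t \<omega> - p k * s.count t \<omega>\<bar> \<le> sqrt (s.count t \<omega> * log_term t / 2)" if "0 < s.count t \<omega>"
  proof -
    have "t \<noteq> 0" using that by (intro notI) (simp add: s.count_def)
    hence "\<omega> \<notin> s.deviates (log_term t) t" using \<omega>(2) t k by (auto simp: bad_def)
    thus ?thesis using \<omega>(1) that by (auto simp: s.deviates_def)
  qed
  have l: "(if t = 0 then 0 else log_term t) \<le> log_term T" "1 / 2 \<le> log_term T"
    using log_term_mono[of t T] log_term_ge[of T] T_ge_1 t by auto
  have c0: "s.count 0 \<omega> = 0" by (simp add: s.count_def)
  have index: "p_bar \<delta> k t \<omega> = min 1 ((if 0 < s.count t \<omega> then s.total t \<omega> / s.count t \<omega> else 0)
      + (if s.count t \<omega> = 0 then 1 else sqrt ((if t = 0 then 0 else log_term t) / (2 * s.count t \<omega>))))"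
    using c0 unfolding p_bar_def p_hat_def beta_p_def log_term_def n tot by (cases "t = 0") (auto simp: n)
  have "0 \<le> s.count t \<omega>" using s.count_nat[of t \<omega>] t \<omega>(1) by auto
  note * = ucb_index_bounds[OF this s.q_01 l _ index]
  show "p k \<le> p_bar \<delta> k t \<omega>"
    using dev c0 by (intro *) (cases "t = 0"; auto)
  show "p_bar \<delta> k t \<omega> - p k \<le> sqrt (2 * log_term T) * inv_sqrt1 (\<Sum>s=1..t. p_sampled k s \<omega>)"
    unfolding s.count_def[symmetric] using dev c0 by (intro *) (cases "t = 0"; auto)
qed

end

section \<open>Drift of the quadratic Lyapunov function\<close>

lemma integral_sum_diff:
  fixes f g h :: "'k \<Rightarrow> 'a \<Rightarrow> real"
  assumes "\<And>k. k \<in> A \<Longrightarrow> integrable M (f k)" "\<And>k. k \<in> A \<Longrightarrow> integrable M (g k)"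
    "\<And>k. k \<in> A \<Longrightarrow> integrable M (h k)"
  shows "(\<integral>\<omega>. (\<Sum>k\<in>A. f k \<omega> - g k \<omega>) - (\<Sum>k\<in>A. h k \<omega>) \<partial>M) =
    (\<Sum>k\<in>A. (\<integral>\<omega>. f k \<omega> \<partial>M) - (\<integral>\<omega>. g k \<omega> \<partial>M)) - (\<Sum>k\<in>A. \<integral>\<omega>. h k \<omega> \<partial>M)"
  using assms by (simp add: Bochner_Integration.integral_sum)

context ucb_dpp
begin

text \<open>Half the derivative of the Lyapunov function in the length of queue k, and at the same
  time the weight with which the policy scores that queue.\<close>

definition rq :: "nat \<Rightarrow> nat \<Rightarrow> 'a \<Rightarrow> real" where
  "rq t k \<omega> = r k * real (Q t k \<omega>)"

lemma rq_bounds: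
  assumes "t \<in> {1..T}" "k \<in> {1..K}" "\<omega> \<in> space M"
  shows "0 \<le> rq t k \<omega>" and "rq t k \<omega> \<le> rmax * real T"
  unfolding rq_def using param_bounds(1,2)[OF assms(2)] Q_le_T[OF assms] param_bounds(5)
  by (auto intro!: mult_mono)

lemma rq_abs_le: "t \<in> {1..T} \<Longrightarrow> k \<in> {1..K} \<Longrightarrow> \<omega> \<in> space M \<Longrightarrow> \<bar>rq t k \<omega>\<bar> \<le> rmax * real T"
  using rq_bounds[of t k \<omega>] by auto

text \<open>The conditional mean drift of slot \<open>t\<close> given the past, \<open>X\<^sub>t\<close>, \<open>c\<^sub>t\<close> and \<open>a\<^sub>t\<close>.\<close>

definition drift :: "nat \<Rightarrow> 'a \<Rightarrow> real" where
  "drift t \<omega> = (\<Sum>k=1..K. rq t k \<omega> * of_bool (X t \<omega> = k) * (1 - p k * c t \<omega>))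
     - (\<Sum>k=1..K. rq t k \<omega> * of_bool (a t \<omega> = k) * mu k)"

definition net_input :: "nat \<Rightarrow> 'a \<Rightarrow> real" where
  "net_input t \<omega> = (\<Sum>k=1..K. rq t k \<omega> * (real (arrival t k \<omega>) - real (departure t k \<omega>)))"

text \<open>Each queue moves by at most 1, so the squared increments cost at most
  \<open>rmax\<close> per queue, and the cross terms add up to 2 \<open>net_input\<close>. A
  departure never exceeds the queue length, which makes the subtraction exact.\<close>

lemma lyapunov_step:
  assumes t: "t \<in> {1..T}" and \<omega>: "\<omega> \<in> space M"
  shows "(\<Sum>k=1..K. r k * (real (Q (t + 1) k \<omega>))\<^sup>2) \<le>
    (\<Sum>k=1..K. r k * (real (Q t k \<omega>))\<^sup>2) + 2 * net_input t \<omega> + real K * rmax"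
proof -
  have "r k * (real (Q (t + 1) k \<omega>))\<^sup>2 \<le> r k * (real (Q t k \<omega>))\<^sup>2
      + 2 * (rq t k \<omega> * (real (arrival t k \<omega>) - real (departure t k \<omega>))) + rmax"
    if k: "k \<in> {1..K}" for k
  proof -
    define d where "d = real (arrival t k \<omega>) - real (departure t k \<omega>)"
    have A: "real (arrival t k \<omega>) \<le> 1" using arrival_le[of t k \<omega>] by simp
    have D: "departure t k \<omega> \<le> 1" "departure t k \<omega> \<le> Q t k \<omega>"
      using departure_le[OF t k \<omega>] by auto
    have "\<bar>d\<bar> \<le> 1" using A D(1) unfolding d_def by auto
    hence "d\<^sup>2 \<le> 1" by (simp add: abs_square_le_1)
    have "real (Q (t + 1) k \<omega>) = real (Q t k \<omega>) + d"
      unfolding Q_step[OF t k \<omega>] d_def using D(2) by (simp add: of_nat_diff)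
    hence "r k * (real (Q (t + 1) k \<omega>))\<^sup>2 = r k * (real (Q t k \<omega>))\<^sup>2 + 2 * (rq t k \<omega> * d) + r k * d\<^sup>2"
      by (simp add: rq_def power2_eq_square algebra_simps)
    moreover have "r k * d\<^sup>2 \<le> rmax * 1"
      using param_bounds(1,2)[OF k] \<open>d\<^sup>2 \<le> 1\<close> by (intro mult_mono) auto
    ultimately show ?thesis unfolding d_def by simp
  qed
  hence "(\<Sum>k=1..K. r k * (real (Q (t + 1) k \<omega>))\<^sup>2) \<le> (\<Sum>k=1..K. r k * (real (Q t k \<omega>))\<^sup>2
      + 2 * (rq t k \<omega> * (real (arrival t k \<omega>) - real (departure t k \<omega>))) + rmax)"
    by (rule sum_mono)
  also have "\<dots> = (\<Sum>k=1..K. r k * (real (Q t k \<omega>))\<^sup>2) + 2 * net_input t \<omega> + real K * rmax"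
    by (simp add: sum.distrib net_input_def sum_distrib_left)
  finally show ?thesis .
qed

lemma lyapunov_le:
  assumes \<omega>: "\<omega> \<in> space M"
  shows "(\<Sum>k=1..K. r k * (real (Q (T + 1) k \<omega>))\<^sup>2) \<le>
    2 * (\<Sum>t=1..T. net_input t \<omega>) + real T * (real K * rmax)"
proof -
  have "(\<Sum>k=1..K. r k * (real (Q (n + 1) k \<omega>))\<^sup>2) \<le>
      2 * (\<Sum>t=1..n. net_input t \<omega>) + real n * (real K * rmax)" if "n \<le> T" for n
    using that
  proof (induction n)
    case 0
    show ?case using Q_init \<omega> by simp
  next
    case (Suc n)
    thus ?case using lyapunov_step[of "Suc n" \<omega>] \<omega> by (simp add: algebra_simps)
  qed
  thus ?thesis by simp
qed

lemma slot_measurable_nat_M: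
  assumes "t \<in> {1..T}"
  shows "X t \<in> M \<rightarrow>\<^sub>M count_space UNIV" "a t \<in> M \<rightarrow>\<^sub>M count_space UNIV" "c t \<in> borel_measurable M"
    "Y t \<in> M \<rightarrow>\<^sub>M count_space UNIV" "k \<in> {1..K} \<Longrightarrow> B t k \<in> M \<rightarrow>\<^sub>M count_space UNIV"
    "k \<in> {1..K} \<Longrightarrow> rq t k \<in> borel_measurable M"
proof -
  show "rq t k \<in> borel_measurable M" if k: "k \<in> {1..K}"
    unfolding rq_def using measurable_real_of_nat_subset[OF Q_measurable_M[of t k]] assms k by auto
qed (use measurable_nat_of_subset[OF X_measurable] measurable_nat_of_subset[OF a_measurable] c_measurable
      measurable_nat_of_subset[OF Y_measurable] measurable_nat_of_subset[OF B_measurable] assms in auto)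

text \<open>Given the decision algebra, the weights and the indicators of type and chosen queue are
  known; only the outcomes \<open>Y\<close> and \<open>B\<close> remain random and may be replaced
  by their conditional means.\<close>

lemma expectation_net_input:
  assumes t: "t \<in> {1..T}"
  shows "integrable M (net_input t)" and "integrable M (drift t)"
    and "(\<integral>\<omega>. net_input t \<omega> \<partial>M) = (\<integral>\<omega>. drift t \<omega> \<partial>M)"
proof -
  let ?x = "\<lambda>k \<omega>. rq t k \<omega> * of_bool (X t \<omega> = k)"
  let ?a = "\<lambda>k \<omega>. rq t k \<omega> * of_bool (a t \<omega> = k)"
  have rq_dec: "rq t k \<in> borel_measurable (decision_algebra t)" if "k \<in> {1..K}" for k
    unfolding rq_def using measurable_real_of_nat_subset[OF decision_measurable_nat(4)[of t t k]] t that by auto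
  have x_dec: "?x k \<in> borel_measurable (decision_algebra t)"
    and a_dec: "?a k \<in> borel_measurable (decision_algebra t)" if k: "k \<in> {1..K}" for k
  proof -
    have [measurable]: "X t \<in> decision_algebra t \<rightarrow>\<^sub>M count_space UNIV" "a t \<in> decision_algebra t \<rightarrow>\<^sub>M count_space UNIV"
      using decision_measurable_nat[of t t] t by auto
    note [measurable] = rq_dec[OF k]
    show "?x k \<in> borel_measurable (decision_algebra t)" "?a k \<in> borel_measurable (decision_algebra t)"
      by measurable
  qed
  have bnd: "\<bar>?x k \<omega>\<bar> \<le> rmax * real T" "\<bar>?a k \<omega>\<bar> \<le> rmax * real T" if "k \<in> {1..K}" "\<omega> \<in> space M" for k \<omega>
    using rq_abs_le[OF t that] param_bounds(5) by auto
  note [measurable] = slot_measurable_nat_M[OF t]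
  have int_x: "integrable M (\<lambda>\<omega>. ?x k \<omega> * f \<omega>)"
    and int_a: "integrable M (\<lambda>\<omega>. ?a k \<omega> * f \<omega>)"
    if k: "k \<in> {1..K}" and f: "f \<in> borel_measurable M" "\<And>\<omega>. \<omega> \<in> space M \<Longrightarrow> \<bar>f \<omega>\<bar> \<le> 1" for f k
  proof -
    note [measurable] = f(1) slot_measurable_nat_M(6)[OF t k]
    have "\<bar>?x k \<omega> * f \<omega>\<bar> \<le> rmax * real T" "\<bar>?a k \<omega> * f \<omega>\<bar> \<le> rmax * real T" if "\<omega> \<in> space M" for \<omega>
      using mult_mono[OF bnd(1)[OF k that] f(2)[OF that]] mult_mono[OF bnd(2)[OF k that] f(2)[OF that]] param_bounds(5)
      by (auto simp: abs_mult)
    thus "integrable M (\<lambda>\<omega>. ?x k \<omega> * f \<omega>)" "integrable M (\<lambda>\<omega>. ?a k \<omega> * f \<omega>)"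
      by (auto intro!: integrable_bounded[of _ "rmax * real T"])
  qed
  have int1: "integrable M (\<lambda>\<omega>. ?x k \<omega> * 1)" "integrable M (\<lambda>\<omega>. ?x k \<omega> * real (Y t \<omega>))"
    "integrable M (\<lambda>\<omega>. ?x k \<omega> * (p k * c t \<omega>))" if k: "k \<in> {1..K}" for k
  proof (goal_cases)
    case 2
    show ?case using Y_in[OF t] by (intro int_x k) force+
  next
    case 3
    show ?case using c_01[OF t] param_bounds(3)[OF k] by (intro int_x k) (auto, fastforce)
  qed (rule int_x[OF k], auto)
  have int2: "integrable M (\<lambda>\<omega>. ?a k \<omega> * real (B t k \<omega>))" "integrable M (\<lambda>\<omega>. ?a k \<omega> * mu k)"
    if k: "k \<in> {1..K}" for k
  proof (goal_cases)
    case 1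
    note [measurable] = slot_measurable_nat_M(5)[OF t k]
    show ?case using B_in[OF t k] by (intro int_a k) force+
  qed (rule int_a[OF k], use param_bounds(4)[OF k] in auto)
  \<comment> \<open>The indicator of a nonempty queue in a departure is absorbed, because the weight
    \<open>rq\<close> of an empty queue is 0.\<close>
  have net: "net_input t \<omega> = (\<Sum>k=1..K. ?x k \<omega> * 1 - ?x k \<omega> * real (Y t \<omega>)) - (\<Sum>k=1..K. ?a k \<omega> * real (B t k \<omega>))"
    if \<omega>: "\<omega> \<in> space M" for \<omega>
    unfolding net_input_def sum_subtractf[symmetric]
    using Y_in[OF t \<omega>] by (intro sum.cong) (auto simp: rq_def arrival_def departure_def algebra_simps)
  have drift: "drift t = (\<lambda>\<omega>. (\<Sum>k=1..K. ?x k \<omega> * 1 - ?x k \<omega> * (p k * c t \<omega>)) - (\<Sum>k=1..K. ?a k \<omega> * mu k))"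
    by (simp add: drift_def fun_eq_iff algebra_simps)
  show "integrable M (drift t)"
    unfolding drift using int1 int2
    by (intro Bochner_Integration.integrable_diff Bochner_Integration.integrable_sum) auto
  have "integrable M (\<lambda>\<omega>. (\<Sum>k=1..K. ?x k \<omega> * 1 - ?x k \<omega> * real (Y t \<omega>)) - (\<Sum>k=1..K. ?a k \<omega> * real (B t k \<omega>)))"
    using int1 int2 by (intro Bochner_Integration.integrable_diff Bochner_Integration.integrable_sum) auto
  moreover have "integrable M (net_input t) \<longleftrightarrow> integrable M (\<lambda>\<omega>.
      (\<Sum>k=1..K. ?x k \<omega> * 1 - ?x k \<omega> * real (Y t \<omega>)) - (\<Sum>k=1..K. ?a k \<omega> * real (B t k \<omega>)))"
    by (rule Bochner_Integration.integrable_cong[OF refl net])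
  ultimately show "integrable M (net_input t)" by blast
  have Y: "(\<integral>\<omega>. ?x k \<omega> * real (Y t \<omega>) \<partial>M) = (\<integral>\<omega>. ?x k \<omega> * (p k * c t \<omega>) \<partial>M)" if k: "k \<in> {1..K}" for k
  proof -
    have "(\<integral>\<omega>. ?x k \<omega> * real (Y t \<omega>) \<partial>M) = (\<integral>\<omega>. ?x k \<omega> * (p (X t \<omega>) * c t \<omega>) \<partial>M)"
      by (rule integral_mult_Y[OF t x_dec[OF k] bnd(1)[OF k]])
    also have "\<dots> = (\<integral>\<omega>. ?x k \<omega> * (p k * c t \<omega>) \<partial>M)"
      by (intro Bochner_Integration.integral_cong) auto
    finally show ?thesis .
  qed
  have B: "(\<integral>\<omega>. ?a k \<omega> * real (B t k \<omega>) \<partial>M) = (\<integral>\<omega>. ?a k \<omega> * mu k \<partial>M)" if k: "k \<in> {1..K}" for k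
    using integral_mult_B[OF t k a_dec[OF k] bnd(2)[OF k]] by simp
  have "(\<integral>\<omega>. net_input t \<omega> \<partial>M) =
      (\<integral>\<omega>. (\<Sum>k=1..K. ?x k \<omega> * 1 - ?x k \<omega> * real (Y t \<omega>)) - (\<Sum>k=1..K. ?a k \<omega> * real (B t k \<omega>)) \<partial>M)"
    using net by (rule Bochner_Integration.integral_cong[OF refl])
  also have "\<dots> = (\<Sum>k=1..K. (\<integral>\<omega>. ?x k \<omega> * 1 \<partial>M) - (\<integral>\<omega>. ?x k \<omega> * real (Y t \<omega>) \<partial>M))
      - (\<Sum>k=1..K. \<integral>\<omega>. ?a k \<omega> * real (B t k \<omega>) \<partial>M)"
    using int1(1,2) int2(1) by (rule integral_sum_diff)
  also have "\<dots> = (\<Sum>k=1..K. (\<integral>\<omega>. ?x k \<omega> * 1 \<partial>M) - (\<integral>\<omega>. ?x k \<omega> * (p k * c t \<omega>) \<partial>M))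
      - (\<Sum>k=1..K. \<integral>\<omega>. ?a k \<omega> * mu k \<partial>M)"
    using Y B by simp
  also have "\<dots> = (\<integral>\<omega>. drift t \<omega> \<partial>M)"
    unfolding drift using int1(1,3) int2(2) by (rule integral_sum_diff[symmetric])
  finally show "(\<integral>\<omega>. net_input t \<omega> \<partial>M) = (\<integral>\<omega>. drift t \<omega> \<partial>M)" .
qed

section \<open>Comparison with the stabilizing randomized policy\<close>

text \<open>The randomized policy enters through its mean allocation, without auxiliary randomness.
  The realized arrival type and the queues of UCB-DPP are kept, so that the comparison with
  \<open>drift\<close> can be made for each outcome.\<close>

definition comparison_drift :: "(nat \<Rightarrow> real) \<Rightarrow> (nat \<Rightarrow> real) \<Rightarrow> nat \<Rightarrow> 'a \<Rightarrow> real" where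
  "comparison_drift ce rho t \<omega> = (\<Sum>k=1..K. rq t k \<omega> * of_bool (X t \<omega> = k) * (1 - p k * ce k))
     - (\<Sum>k=1..K. rq t k \<omega> * (mu k * rho k))"

text \<open>The weights are functions of the past and hence independent of the arrival, which
  replaces its indicator by \<open>lam k\<close>; each queue then contributes a nonnegative mean
  weight times a nonpositive rate.\<close>

lemma expectation_comparison_drift:
  assumes t: "t \<in> {1..T}"
    and stable: "\<And>k. k \<in> {1..K} \<Longrightarrow> lam k * (1 - p k * ce k) \<le> mu k * rho k"
  shows "integrable M (comparison_drift ce rho t)"
    and "(\<integral>\<omega>. comparison_drift ce rho t \<omega> \<partial>M) \<le> 0"
proof -
  note [measurable] = slot_measurable_nat_M[OF t]
  have rq_past: "rq t k \<in> borel_measurable (past_algebra t)" if "k \<in> {1..K}" for k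
    unfolding rq_def using measurable_real_of_nat_subset[OF Q_measurable_past[of t k]] t that by auto
  have int_rq: "integrable M (rq t k)" if k: "k \<in> {1..K}" for k
    by (rule integrable_bounded[OF slot_measurable_nat_M(6)[OF t k] rq_abs_le[OF t k]])
  have int_x: "integrable M (\<lambda>\<omega>. rq t k \<omega> * of_bool (X t \<omega> = k))" if k: "k \<in> {1..K}" for k
    using rq_abs_le[OF t k] param_bounds(5) slot_measurable_nat_M(6)[OF t k]
    by (intro integrable_bounded[of _ "rmax * real T"]) (auto simp: of_bool_def)
  show "integrable M (comparison_drift ce rho t)"
    unfolding comparison_drift_def using int_x int_rq
    by (intro Bochner_Integration.integrable_diff Bochner_Integration.integrable_sum integrable_mult_left) auto
  let ?f = "\<lambda>k \<omega>. rq t k \<omega> * of_bool (X t \<omega> = k) * (1 - p k * ce k)"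
  let ?h = "\<lambda>k \<omega>. rq t k \<omega> * (mu k * rho k)"
  have int_f: "integrable M (?f k)" and int_h: "integrable M (?h k)" if k: "k \<in> {1..K}" for k
    using int_x[OF k] int_rq[OF k] by auto
  have "(\<integral>\<omega>. comparison_drift ce rho t \<omega> \<partial>M) =
      (\<integral>\<omega>. (\<Sum>k=1..K. ?f k \<omega>) \<partial>M) - (\<integral>\<omega>. (\<Sum>k=1..K. ?h k \<omega>) \<partial>M)"
    unfolding comparison_drift_def
    by (intro Bochner_Integration.integral_diff Bochner_Integration.integrable_sum int_f int_h)
  also have "\<dots> = (\<Sum>k=1..K. \<integral>\<omega>. ?f k \<omega> \<partial>M) - (\<Sum>k=1..K. \<integral>\<omega>. ?h k \<omega> \<partial>M)"
    by (intro arg_cong2[where f = "(-)"] Bochner_Integration.integral_sum int_f int_h)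
  also have "\<dots> =
      (\<Sum>k=1..K. (\<integral>\<omega>. rq t k \<omega> * of_bool (X t \<omega> = k) \<partial>M) * (1 - p k * ce k))
      - (\<Sum>k=1..K. (\<integral>\<omega>. rq t k \<omega> \<partial>M) * (mu k * rho k))"
    by simp
  also have "\<dots> = (\<Sum>k=1..K. (\<integral>\<omega>. rq t k \<omega> \<partial>M) * (lam k * (1 - p k * ce k) - mu k * rho k))"
    unfolding sum_subtractf[symmetric]
    using integral_mult_X[OF t _ rq_past rq_abs_le[OF t]] by (intro sum.cong) (auto simp: algebra_simps)
  also have "\<dots> \<le> 0"
    using stable rq_bounds(1)[OF t]
    by (intro sum_nonpos mult_nonneg_nonpos integral_nonneg_AE) auto
  finally show "(\<integral>\<omega>. comparison_drift ce rho t \<omega> \<partial>M) \<le> 0" .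
qed

lemma sum_pick: "x \<in> {1..K} \<Longrightarrow> (\<Sum>k=1..K. f k * of_bool (x = k) * g k) = (f x * g x :: real)"
  by (simp add: sum.remove[of _ x] of_bool_def)

text \<open>A subconvex combination lies below a common bound; since the weights may sum to less
  than 1, the bound must be nonnegative.\<close>

lemma sum_rho_weighted_le:
  fixes f :: "nat \<Rightarrow> real"
  assumes rho: "\<And>k. k \<in> {1..K} \<Longrightarrow> 0 \<le> rho k" "(\<Sum>k=1..K. rho k) \<le> 1"
    and f: "\<And>k. k \<in> {1..K} \<Longrightarrow> f k \<le> m" and m: "0 \<le> m"
  shows "(\<Sum>k=1..K. f k * rho k) \<le> m"
proof -
  have "(\<Sum>k=1..K. f k * rho k) \<le> (\<Sum>k=1..K. m * rho k)"
    using rho(1) f by (intro sum_mono mult_right_mono) auto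
  also have "\<dots> = m * (\<Sum>k=1..K. rho k)" by (simp add: sum_distrib_left)
  also have "\<dots> \<le> m * 1" using rho(2) m by (intro mult_left_mono) auto
  finally show ?thesis by simp
qed

context
  fixes ce rho :: "nat \<Rightarrow> real"
  assumes ce: "\<And>k. k \<in> {1..K} \<Longrightarrow> ce k \<in> {0..1}"
    and rho: "\<And>k. k \<in> {1..K} \<Longrightarrow> 0 \<le> rho k" "(\<Sum>k=1..K. rho k) \<le> 1"
begin

text \<open>A single arrival and at most unit total service allocation bound \<open>drift\<close>
  above by \<open>rmax * T\<close> and \<open>comparison_drift\<close> below by its negative,
  whatever the estimates are.\<close>

lemma drift_le_bad:
  assumes t: "t \<in> {1..T}" and \<omega>: "\<omega> \<in> space M"
  shows "drift t \<omega> \<le> comparison_drift ce rho t \<omega> + 2 * (rmax * real T)"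
proof -
  define x where "x = X t \<omega>"
  have x: "x \<in> {1..K}" using X_in t \<omega> by (simp add: x_def)
  have pc: "0 \<le> p x * y" "p x * y \<le> 1" if "y \<in> {0..1}" for y
    using param_bounds(3)[OF x] that by (auto simp: mult_le_one)
  have c: "c t \<omega> \<in> {0..1}" using c_range t \<omega> by auto
  have "drift t \<omega> \<le> rq t x \<omega> * (1 - p x * c t \<omega>)"
    unfolding drift_def x_def[symmetric] sum_pick[OF x]
    using rq_bounds(1)[OF t _ \<omega>] param_bounds(4) sum_nonneg[of "{1..K}" "\<lambda>k. rq t k \<omega> * of_bool (a t \<omega> = k) * mu k"]
    by auto
  also have "\<dots> \<le> rq t x \<omega> * 1"
    using rq_bounds(1)[OF t x \<omega>] pc(1)[OF c] by (intro mult_left_mono) auto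
  also have "\<dots> \<le> rmax * real T" using rq_bounds(2)[OF t x \<omega>] by simp
  finally have 1: "drift t \<omega> \<le> rmax * real T" .
  have "(\<Sum>k=1..K. (rq t k \<omega> * mu k) * rho k) \<le> rmax * real T"
  proof (rule sum_rho_weighted_le[OF rho])
    fix k assume k: "k \<in> {1..K}"
    have "rq t k \<omega> * mu k \<le> rq t k \<omega> * 1"
      using rq_bounds(1)[OF t k \<omega>] param_bounds(4)[OF k] by (intro mult_left_mono) auto
    thus "rq t k \<omega> * mu k \<le> rmax * real T" using rq_bounds(2)[OF t k \<omega>] by simp
  qed (use param_bounds(5) in auto)
  moreover have "0 \<le> rq t x \<omega> * (1 - p x * ce x)"
    using rq_bounds(1)[OF t x \<omega>] pc(2)[OF ce[OF x]] by simp
  ultimately have "- (rmax * real T) \<le> comparison_drift ce rho t \<omega>"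
    unfolding comparison_drift_def x_def[symmetric] sum_pick[OF x] by (simp add: mult.assoc)
  with 1 show ?thesis by simp
qed

text \<open>
  \<open>c\<^sub>t\<close> minimizes \<open>V c - r Q pbar c\<close> and \<open>a\<^sub>t\<close> maximizes \<open>r Q mubar\<close>, so on the good event the
  policy loses to the comparison policy at most \<open>V\<close> plus the estimation errors.
\<close>

lemma drift_le_good:
  assumes t: "t \<in> {1..T}" and \<omega>: "\<omega> \<in> space M" "\<omega> \<notin> bad"
    and Yc: "\<forall>t\<in>{1..T}. real (Y t \<omega>) \<le> c t \<omega>"
  shows "drift t \<omega> \<le> comparison_drift ce rho t \<omega> + V + rmax * real T * sqrt (2 * log_term T) *
    ((\<Sum>k=1..K. p_sampled k t \<omega> * inv_sqrt1 (\<Sum>s=1..t-1. p_sampled k s \<omega>)) +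
     (\<Sum>k=1..K. mu_sampled k t \<omega> * inv_sqrt1 (\<Sum>s=1..t-1. mu_sampled k s \<omega>)))"
proof -
  define x where "x = X t \<omega>"
  define j where "j = a t \<omega>"
  define e where "e = rmax * real T * sqrt (2 * log_term T)"
  have x: "x \<in> {1..K}" using X_in t \<omega> by (simp add: x_def)
  have j: "j \<in> {1..K}" using a_in t \<omega> by (simp add: j_def)
  have t1: "t - 1 < T" using t by auto
  define pb where "pb = p_bar \<delta> x (t - 1) \<omega>"
  define mb where "mb k = mu_bar \<delta> k (t - 1) \<omega>" for k
  note pbb = p_bar_bounds[OF \<omega> Yc t1 x, folded pb_def]
  note mbb = mu_bar_bounds[OF \<omega> t1, folded mb_def]
  have w: "0 \<le> rq t k \<omega>" "rq t k \<omega> \<le> rmax * real T" if "k \<in> {1..K}" for k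
    using rq_bounds[OF t that \<omega>(1)] by auto
  have cex: "0 \<le> ce x" "ce x \<le> 1" using ce[OF x] by auto
  have px: "0 \<le> p x" "p x \<le> pb" using param_bounds(3)[OF x] pbb(1) by auto

  have c_eq: "c t \<omega> = (if V \<le> rq t x \<omega> * pb then 1 else 0)"
    using c_policy[OF t \<omega>(1)] by (simp add: x_def pb_def rq_def mult.commute mult.left_commute)
  have "rq t x \<omega> * (p x * ce x) \<le> rq t x \<omega> * pb"
    using w(1)[OF x] px cex mult_mono[of "p x" pb "ce x" 1] by (intro mult_left_mono) auto
  \<comment> \<open>At cost 0 the threshold is missed, so the forgone benefit
    \<open>rq * p * ce\<close> is at most \<open>rq * pb\<close> and hence below V. At cost 1 the
    bound just shown suffices. The error thus carries the factor \<open>c t\<close>, that is, it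
    occurs only together with a sample.\<close>
  hence "rq t x \<omega> * (1 - p x * c t \<omega>) \<le> rq t x \<omega> * (1 - p x * ce x) + V + c t \<omega> * (rq t x \<omega> * (pb - p x))"
    using V_pos unfolding c_eq by (simp add: algebra_simps)
  also have "c t \<omega> * (rq t x \<omega> * (pb - p x)) \<le>
      c t \<omega> * ((rmax * real T) * (sqrt (2 * log_term T) * inv_sqrt1 (\<Sum>s=1..t-1. p_sampled x s \<omega>)))"
    using w[OF x] pbb by (intro mult_left_mono mult_mono) (auto simp: c_eq)
  also have "\<dots> = e * (\<Sum>k=1..K. p_sampled k t \<omega> * inv_sqrt1 (\<Sum>s=1..t-1. p_sampled k s \<omega>))"
  proof -
    have slot: "p_sampled k t \<omega> = c t \<omega> * of_bool (x = k)" for k by (simp add: p_sampled_def x_def)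
    show ?thesis unfolding slot sum_pick[OF x] e_def by (simp only: mult_ac)
  qed
  finally have 1: "rq t x \<omega> * (1 - p x * c t \<omega>) \<le> rq t x \<omega> * (1 - p x * ce x) + V +
      e * (\<Sum>k=1..K. p_sampled k t \<omega> * inv_sqrt1 (\<Sum>s=1..t-1. p_sampled k s \<omega>))"
    by simp

  have "(\<Sum>k=1..K. (rq t k \<omega> * mu k) * rho k) \<le> rq t j \<omega> * mb j"
  proof (rule sum_rho_weighted_le[OF rho])
    fix k assume k: "k \<in> {1..K}"
    have "rq t k \<omega> * mu k \<le> rq t k \<omega> * mb k"
      using w(1)[OF k] mbb(1)[OF k] by (intro mult_left_mono)
    also have "\<dots> \<le> rq t j \<omega> * mb j"
      using a_policy[OF t \<omega>(1)] k unfolding is_arg_max_def j_def mb_def rq_def by (auto simp: not_less)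
    finally show "rq t k \<omega> * mu k \<le> rq t j \<omega> * mb j" .
  next
    show "0 \<le> rq t j \<omega> * mb j" using w(1)[OF j] mbb(1)[OF j] param_bounds(4)[OF j] by simp
  qed
  moreover have "rq t j \<omega> * (mb j - mu j) \<le>
      e * (\<Sum>k=1..K. mu_sampled k t \<omega> * inv_sqrt1 (\<Sum>s=1..t-1. mu_sampled k s \<omega>))"
  proof -
    let ?g = "\<lambda>k. inv_sqrt1 (\<Sum>s=1..t-1. mu_sampled k s \<omega>)"
    \<comment> \<open>Serving an empty queue yields no sample, but its error has weight 0; inserting
      the indicator ties the error to \<open>mu_sampled\<close>.\<close>
    have "rq t j \<omega> * (mb j - mu j) = of_bool (0 < Q t j \<omega>) * (rq t j \<omega> * (mb j - mu j))"
      by (cases "Q t j \<omega>") (auto simp: rq_def)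
    also have "\<dots> \<le> of_bool (0 < Q t j \<omega>) * ((rmax * real T) * (sqrt (2 * log_term T) * ?g j))"
      using w[OF j] mbb[OF j] by (intro mult_left_mono mult_mono) auto
    also have "\<dots> = e * (\<Sum>k=1..K. of_bool (0 < Q t k \<omega>) * of_bool (j = k) * ?g k)"
      unfolding e_def sum_pick[OF j] by (simp add: mult_ac)
    also have "(\<Sum>k=1..K. of_bool (0 < Q t k \<omega>) * of_bool (j = k) * ?g k) = (\<Sum>k=1..K. mu_sampled k t \<omega> * ?g k)"
      unfolding mu_sampled_def j_def by (simp add: of_bool_conj mult.commute)
    finally show ?thesis .
  qed
  ultimately have 2: "- (rq t j \<omega> * mu j) \<le> - (\<Sum>k=1..K. rq t k \<omega> * (mu k * rho k)) +
      e * (\<Sum>k=1..K. mu_sampled k t \<omega> * inv_sqrt1 (\<Sum>s=1..t-1. mu_sampled k s \<omega>))"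
    by (simp add: algebra_simps)

  show ?thesis
    using 1 2 unfolding drift_def comparison_drift_def x_def[symmetric] j_def[symmetric] e_def[symmetric]
      sum_pick[OF x] sum_pick[OF j] by (simp add: distrib_left)
qed

section \<open>Summation over the horizon and the second moment of the backlog\<close>

text \<open>The 6 K sqrt T collects 3 sqrt T from \<open>sum_inv_sqrt1_le\<close> for each of the 2
  K arms. On \<open>bad\<close> every slot is charged the crude bound.\<close>

lemma sum_drift_le:
  assumes \<omega>: "\<omega> \<in> space M" and Yc: "\<forall>t\<in>{1..T}. real (Y t \<omega>) \<le> c t \<omega>"
  shows "(\<Sum>t=1..T. drift t \<omega>) \<le> (\<Sum>t=1..T. comparison_drift ce rho t \<omega>) + real T * V
    + 6 * real K * rmax * real T * sqrt (2 * log_term T * real T)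
    + 2 * rmax * (real T)\<^sup>2 * indicator bad \<omega>"
proof -
  define e where "e = rmax * real T * sqrt (2 * log_term T)"
  have l: "0 \<le> log_term T" using log_term_ge[of T] T_ge_1 by simp
  have e0: "0 \<le> e" unfolding e_def using param_bounds(5) l by simp
  have e_eq: "6 * real K * rmax * real T * sqrt (2 * log_term T * real T) = e * (6 * real K * sqrt (real T))"
    unfolding e_def real_sqrt_mult by simp
  show ?thesis
  proof (cases "\<omega> \<in> bad")
    case True
    have "(\<Sum>t=1..T. drift t \<omega>) \<le> (\<Sum>t=1..T. comparison_drift ce rho t \<omega> + 2 * (rmax * real T))"
      by (intro sum_mono drift_le_bad \<omega>)
    also have "\<dots> = (\<Sum>t=1..T. comparison_drift ce rho t \<omega>) + 2 * rmax * (real T)\<^sup>2"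
      by (simp add: sum.distrib power2_eq_square)
    moreover have "0 \<le> real T * V" "0 \<le> e * (6 * real K * sqrt (real T))" using e0 V_pos by auto
    ultimately show ?thesis unfolding e_eq using True by simp
  next
    case False
    let ?P = "\<lambda>t k. p_sampled k t \<omega> * inv_sqrt1 (\<Sum>s=1..t-1. p_sampled k s \<omega>)"
    let ?R = "\<lambda>t k. mu_sampled k t \<omega> * inv_sqrt1 (\<Sum>s=1..t-1. mu_sampled k s \<omega>)"
    have P: "(\<Sum>t=1..T. \<Sum>k=1..K. ?P t k) \<le> real K * (3 * sqrt (real T))"
    proof -
      have "(\<Sum>k=1..K. \<Sum>t=1..T. ?P t k) \<le> (\<Sum>k=1..K. 3 * sqrt (real T))"
        using adaptive_bernoulli_samples.\<xi>_01[OF p_samples] \<omega> by (intro sum_mono sum_inv_sqrt1_le) auto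
      thus ?thesis by (subst sum.swap) simp
    qed
    have R: "(\<Sum>t=1..T. \<Sum>k=1..K. ?R t k) \<le> real K * (3 * sqrt (real T))"
    proof -
      have "(\<Sum>k=1..K. \<Sum>t=1..T. ?R t k) \<le> (\<Sum>k=1..K. 3 * sqrt (real T))"
        using adaptive_bernoulli_samples.\<xi>_01[OF mu_samples] \<omega> by (intro sum_mono sum_inv_sqrt1_le) auto
      thus ?thesis by (subst sum.swap) simp
    qed
    have "(\<Sum>t=1..T. drift t \<omega>) \<le>
        (\<Sum>t=1..T. comparison_drift ce rho t \<omega> + V + e * ((\<Sum>k=1..K. ?P t k) + (\<Sum>k=1..K. ?R t k)))"
      unfolding e_def by (intro sum_mono drift_le_good \<omega> False Yc)
    also have "\<dots> = (\<Sum>t=1..T. comparison_drift ce rho t \<omega>) + real T * V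
        + e * ((\<Sum>t=1..T. \<Sum>k=1..K. ?P t k) + (\<Sum>t=1..T. \<Sum>k=1..K. ?R t k))"
      by (simp add: sum.distrib sum_distrib_left[symmetric])
    also have "\<dots> \<le> (\<Sum>t=1..T. comparison_drift ce rho t \<omega>) + real T * V + e * (6 * real K * sqrt (real T))"
      using P R e0 by (intro add_left_mono mult_left_mono) auto
    finally show ?thesis unfolding e_eq using False by simp
  qed
qed

lemma expectation_Q_square_le:
  assumes stable: "\<And>k. k \<in> {1..K} \<Longrightarrow> lam k * (1 - p k * ce k) \<le> mu k * rho k"
    and k: "k \<in> {1..K}"
  shows "rmin * (\<integral>\<omega>. (real (Q (T + 1) k \<omega>))\<^sup>2 \<partial>M) \<le> real T * (real K * rmax) +
    2 * (real T * V + 6 * real K * rmax * real T * sqrt (2 * log_term T * real T) +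
      2 * rmax * (real T)\<^sup>2 * (real T * \<delta>))"
proof -
  let ?C = "real T * V + 6 * real K * rmax * real T * sqrt (2 * log_term T * real T)"
  let ?D = "2 * rmax * (real T)\<^sup>2"
  have Qm: "(\<lambda>\<omega>. real (Q (T + 1) k \<omega>)) \<in> borel_measurable M"
    using measurable_real_of_nat_subset[OF Q_measurable_M[of "T + 1" k]] k by simp
  have "real (Q (T + 1) k \<omega>) \<le> real T" if "\<omega> \<in> space M" for \<omega>
    using Q_le[of "T + 1" k \<omega>] k that by simp
  hence int_Q: "integrable M (\<lambda>\<omega>. (real (Q (T + 1) k \<omega>))\<^sup>2)"
    using Qm by (intro integrable_bounded[of _ "(real T)\<^sup>2"]) (auto intro!: power_mono)
  have int_net: "integrable M (\<lambda>\<omega>. \<Sum>t=1..T. net_input t \<omega>)"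
    using expectation_net_input(1) by (intro Bochner_Integration.integrable_sum)
  have int_drift: "integrable M (\<lambda>\<omega>. \<Sum>t=1..T. drift t \<omega>)"
    using expectation_net_input(2) by (intro Bochner_Integration.integrable_sum)
  have int_comp: "integrable M (\<lambda>\<omega>. \<Sum>t=1..T. comparison_drift ce rho t \<omega>)"
    using expectation_comparison_drift(1)[OF _ stable] by (intro Bochner_Integration.integrable_sum)
  have int_bad: "integrable M (indicator bad :: 'a \<Rightarrow> real)"
    using bad_meas by (simp add: integrable_indicator_iff emeasure_finite less_top[symmetric])

  have "rmin * (\<integral>\<omega>. (real (Q (T + 1) k \<omega>))\<^sup>2 \<partial>M) = (\<integral>\<omega>. rmin * (real (Q (T + 1) k \<omega>))\<^sup>2 \<partial>M)" by simp
  also have "\<dots> \<le> (\<integral>\<omega>. 2 * (\<Sum>t=1..T. net_input t \<omega>) + real T * (real K * rmax) \<partial>M)"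
  proof (rule integral_mono)
    fix \<omega> assume \<omega>: "\<omega> \<in> space M"
    have "rmin * (real (Q (T + 1) k \<omega>))\<^sup>2 \<le> r k * (real (Q (T + 1) k \<omega>))\<^sup>2"
      using r_range[OF k] by (intro mult_right_mono) auto
    also have "\<dots> \<le> (\<Sum>k=1..K. r k * (real (Q (T + 1) k \<omega>))\<^sup>2)"
    proof (rule member_le_sum[OF k])
      fix i assume "i \<in> {1..K} - {k}"
      thus "0 \<le> r i * (real (Q (T + 1) i \<omega>))\<^sup>2" using param_bounds(1)[of i] by simp
    qed simp
    also have "\<dots> \<le> 2 * (\<Sum>t=1..T. net_input t \<omega>) + real T * (real K * rmax)"
      by (rule lyapunov_le[OF \<omega>])
    finally show "rmin * (real (Q (T + 1) k \<omega>))\<^sup>2 \<le> 2 * (\<Sum>t=1..T. net_input t \<omega>) + real T * (real K * rmax)" .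
  qed (use int_Q int_net in auto)
  also have "\<dots> = 2 * (\<integral>\<omega>. (\<Sum>t=1..T. net_input t \<omega>) \<partial>M) + real T * (real K * rmax)"
    using int_net by (simp add: prob_space)
  also have "(\<integral>\<omega>. (\<Sum>t=1..T. net_input t \<omega>) \<partial>M) = (\<integral>\<omega>. (\<Sum>t=1..T. drift t \<omega>) \<partial>M)"
    using expectation_net_input by (simp add: Bochner_Integration.integral_sum)
  also have "(\<integral>\<omega>. (\<Sum>t=1..T. drift t \<omega>) \<partial>M) \<le>
      (\<integral>\<omega>. (\<Sum>t=1..T. comparison_drift ce rho t \<omega>) + ?C + ?D * indicator bad \<omega> \<partial>M)"
  proof (rule integral_mono_AE)
    \<comment> \<open>The bound may fail only on the null set where the chatbot succeeds at cost
      0.\<close>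
    show "AE \<omega> in M. (\<Sum>t=1..T. drift t \<omega>) \<le>
        (\<Sum>t=1..T. comparison_drift ce rho t \<omega>) + ?C + ?D * indicator bad \<omega>"
      using AE_Y_le_c AE_space by eventually_elim (use sum_drift_le in \<open>simp add: add.assoc\<close>)
  qed (use int_drift int_comp int_bad in auto)
  also have "\<dots> = (\<integral>\<omega>. (\<Sum>t=1..T. comparison_drift ce rho t \<omega>) \<partial>M) + ?C + ?D * prob bad"
    using int_comp int_bad bad_meas by (simp add: prob_space)
  also have "(\<integral>\<omega>. (\<Sum>t=1..T. comparison_drift ce rho t \<omega>) \<partial>M) \<le> 0"
    using expectation_comparison_drift[OF _ stable]
    by (subst Bochner_Integration.integral_sum) (auto intro!: sum_nonpos)
  also have "?D * prob bad \<le> ?D * (real T * \<delta>)"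
    using prob_bad_le param_bounds(5) by (intro mult_left_mono) auto
  finally show ?thesis by simp
qed

lemma expectation_Q_le:
  assumes stable: "\<And>k. k \<in> {1..K} \<Longrightarrow> lam k * (1 - p k * ce k) \<le> mu k * rho k"
    and k: "k \<in> {1..K}"
  shows "(\<integral>\<omega>. real (Q (T + 1) k \<omega>) \<partial>M) \<le> sqrt ((real T * (real K * rmax) +
    2 * (real T * V + 6 * real K * rmax * real T * sqrt (2 * log_term T * real T) +
      2 * rmax * (real T)\<^sup>2 * (real T * \<delta>))) / rmin)"
proof (rule real_le_rsqrt)
  have Qm: "(\<lambda>\<omega>. real (Q (T + 1) k \<omega>)) \<in> borel_measurable M"
    using measurable_real_of_nat_subset[OF Q_measurable_M[of "T + 1" k]] k by simp
  have le: "real (Q (T + 1) k \<omega>) \<le> real T" if "\<omega> \<in> space M" for \<omega>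
    using Q_le[of "T + 1" k \<omega>] k that by simp
  have "integrable M (\<lambda>\<omega>. real (Q (T + 1) k \<omega>))"
    using Qm le by (intro integrable_bounded[of _ "real T"]) auto
  moreover have "integrable M (\<lambda>\<omega>. (real (Q (T + 1) k \<omega>))\<^sup>2)"
    using Qm le by (intro integrable_bounded[of _ "(real T)\<^sup>2"]) (auto intro!: power_mono)
  ultimately have "(\<integral>\<omega>. real (Q (T + 1) k \<omega>) \<partial>M)\<^sup>2 \<le> (\<integral>\<omega>. (real (Q (T + 1) k \<omega>))\<^sup>2 \<partial>M)"
    using variance_positive[of "\<lambda>\<omega>. real (Q (T + 1) k \<omega>)"] by (simp add: variance_eq)
  also have "\<dots> \<le> (real T * (real K * rmax) +
      2 * (real T * V + 6 * real K * rmax * real T * sqrt (2 * log_term T * real T) +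
        2 * rmax * (real T)\<^sup>2 * (real T * \<delta>))) / rmin"
    using expectation_Q_square_le[OF stable k] rmin_pos by (simp add: field_simps)
  finally show "(\<integral>\<omega>. real (Q (T + 1) k \<omega>) \<partial>M)\<^sup>2 \<le> (real T * (real K * rmax) +
      2 * (real T * V + 6 * real K * rmax * real T * sqrt (2 * log_term T * real T) +
        2 * rmax * (real T)\<^sup>2 * (real T * \<delta>))) / rmin" .
qed

end

end

section \<open>Asymptotics of the backlog bound\<close>

text \<open>With the prescribed V and \<delta> the logarithm is ln (4 \<kappa> T^3) and the bad
  event contributes order T. The dominant term under the root is T^(3/2) (ln T)^(1/2), so the
  quotient is of order (ln T / T)^(1/4).\<close>

lemma backlog_bound_sublinear:
  fixes \<kappa> rmin rmax :: real
  assumes "1 \<le> \<kappa>" "0 < rmin" "0 < rmax"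
  shows "(\<lambda>T::nat. sqrt ((real T * (\<kappa> * rmax) +
    2 * (real T * sqrt (real T)
      + 6 * \<kappa> * rmax * real T * sqrt (2 * ln (4 * \<kappa> * real T / (1 / (real T)\<^sup>2)) * real T)
      + 2 * rmax * (real T)\<^sup>2 * (real T * (1 / (real T)\<^sup>2)))) / rmin) / real T) \<longlonglongrightarrow> 0"
proof -
  have "0 < \<kappa>" using assms by simp
  thus ?thesis using assms(2,3) by real_asymp
qed

theorem mainTheorem2:
  fixes K :: nat
    and lam p mu r :: "nat \<Rightarrow> real"
    and rmin rmax :: real
    and M :: "nat \<Rightarrow> 'a measure"
    and X :: "nat \<Rightarrow> nat \<Rightarrow> 'a \<Rightarrow> nat"
    and c :: "nat \<Rightarrow> nat \<Rightarrow> 'a \<Rightarrow> real"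
    and a :: "nat \<Rightarrow> nat \<Rightarrow> 'a \<Rightarrow> nat"
    and Y :: "nat \<Rightarrow> nat \<Rightarrow> 'a \<Rightarrow> nat"
    and B :: "nat \<Rightarrow> nat \<Rightarrow> nat \<Rightarrow> 'a \<Rightarrow> nat"
    and Q :: "nat \<Rightarrow> nat \<Rightarrow> nat \<Rightarrow> 'a \<Rightarrow> nat"
  assumes params: "human_ai_params K lam p mu r rmin rmax"
    and slack: "\<exists>\<epsilon> ceps rho. 0 < \<epsilon>
      \<and> (\<forall>k\<in>{1..K}. ceps k \<in> {0..1::real} \<and> 0 \<le> rho k
            \<and> lam k * (1 - p k * ceps k) + \<epsilon> \<le> mu k * rho k)
      \<and> (\<Sum>k=1..K. rho k) \<le> 1"
    and run: "\<And>T. 2 \<le> T \<Longrightarrow>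
      ucb_dpp K lam p mu r rmin rmax T (M T) (X T) (c T) (a T) (Y T) (B T) (Q T)
        (sqrt (real T)) (1 / (real T)\<^sup>2)"
  shows "\<forall>k\<in>{1..K}.
    (\<lambda>T. (\<integral>\<omega>. real (Q T (T + 1) k \<omega>) \<partial>(M T)) / real T) \<longlonglongrightarrow> 0"
proof
  fix k assume k: "k \<in> {1..K}"
  obtain \<epsilon> ce rho where \<epsilon>: "0 < \<epsilon>"
    and H: "\<And>k. k \<in> {1..K} \<Longrightarrow> ce k \<in> {0..1::real} \<and> 0 \<le> rho k
            \<and> lam k * (1 - p k * ce k) + \<epsilon> \<le> mu k * rho k"
    and rho: "(\<Sum>k=1..K. rho k) \<le> 1"
    using slack by metis
  have stable: "lam k * (1 - p k * ce k) \<le> mu k * rho k" if "k \<in> {1..K}" for k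
    using H[OF that] \<epsilon> by linarith
  interpret params: human_ai_params K lam p mu r rmin rmax by (rule params)
  let ?b = "\<lambda>T::nat. sqrt ((real T * (real K * rmax) +
    2 * (real T * sqrt (real T)
      + 6 * real K * rmax * real T * sqrt (2 * ln (4 * real K * real T / (1 / (real T)\<^sup>2)) * real T)
      + 2 * rmax * (real T)\<^sup>2 * (real T * (1 / (real T)\<^sup>2)))) / rmin)"
  have le: "(\<integral>\<omega>. real (Q T (T + 1) k \<omega>) \<partial>(M T)) \<le> ?b T" if T: "2 \<le> T" for T
  proof -
    interpret ucb_dpp K lam p mu r rmin rmax T "M T" "X T" "c T" "a T" "Y T" "B T" "Q T"
      "sqrt (real T)" "1 / (real T)\<^sup>2"
      by (rule run[OF T])
    show ?thesis
      using expectation_Q_le[of ce rho k] H rho stable k unfolding log_term_def by blast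
  qed
  show "(\<lambda>T. (\<integral>\<omega>. real (Q T (T + 1) k \<omega>) \<partial>(M T)) / real T) \<longlonglongrightarrow> 0"
  proof (rule tendsto_sandwich[OF _ _ tendsto_const])
    show "\<forall>\<^sub>F T in sequentially. 0 \<le> (\<integral>\<omega>. real (Q T (T + 1) k \<omega>) \<partial>(M T)) / real T"
      by (intro always_eventually allI divide_nonneg_nonneg integral_nonneg_AE) auto
    show "\<forall>\<^sub>F T in sequentially. (\<integral>\<omega>. real (Q T (T + 1) k \<omega>) \<partial>(M T)) / real T \<le> ?b T / real T"
      using eventually_ge_at_top[of 2] by eventually_elim (use le in \<open>auto intro!: divide_right_mono\<close>)
    show "(\<lambda>T. ?b T / real T) \<longlonglongrightarrow> 0"
      using params.K_ge_1 params.rmin_pos params.rmin_less_rmax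
      by (intro backlog_bound_sublinear) auto
  qed
qed

end
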